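(* Let $(M,g)$ be a Riemannian manifold. The function that assigns to each point $p\in M$ its holonomy radius $\mathrm{HolRad}_M(p)$ is strictly positive.
   Context: Let $M_p=T_pM$ be the tangent space at $p$ with the norm given by $g$. Let $\mathrm{Hol}_p$ be the holonomy group at $p$ of the Levi-Civita connection, i.e. the group of all parallel translations $P^\alpha_1:M_p\to M_p$ along piecewise smooth loops $\alpha:[0,1]\to M$ based at $p$. The associated length norm on $\mathrm{Hol}_p$ is $$L_p(a)=\inf\{\ell(\alpha):\alpha\text{ a piecewise smooth loop at }p\text{ with }P^\alpha_1=a\},$$ where $\ell$ denotes length with respect to $g$. The holonomy radius $\mathrm{HolRad}_M(p)$ is the supremum (possibly $+\infty$) of the $r>0$ such that for all $u,v\in M_p$ with $\|u\|,\|v\|\le r$ and all $a\in\mathrm{Hol}_p$, $$\|u-v\|^2-\|au-v\|^2\le L_p^2(a).$$ *)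

theory Defs
  imports "HOL-Analysis.Analysis"
begin

section \<open>Smooth manifolds\<close>

primrec Ck_on :: "nat \<Rightarrow> 'a::real_normed_vector set \<Rightarrow> ('a \<Rightarrow> 'b::real_normed_vector) \<Rightarrow> bool" where
  "Ck_on 0 S f \<longleftrightarrow> continuous_on S f"
| "Ck_on (Suc k) S f \<longleftrightarrow>
     (\<forall>x\<in>S. f differentiable (at x)) \<and> (\<forall>v. Ck_on k S (\<lambda>x. frechet_derivative f (at x) v))"

text \<open>Only meant for open \<open>S\<close>.\<close>

definition smooth_on :: "'a::real_normed_vector set \<Rightarrow> ('a \<Rightarrow> 'b::real_normed_vector) \<Rightarrow> bool" where
  "smooth_on S f \<longleftrightarrow> (\<forall>k. Ck_on k S f)"

text \<open>The values of \<open>cmap c\<close> outside \<open>cdom c\<close> are irrelevant.\<close>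

datatype ('a, 'e) chart = Chart (cdom: "'a set") (cmap: "'a \<Rightarrow> 'e")

abbreviation crange :: "('a, 'e) chart \<Rightarrow> 'e set" where
  "crange c \<equiv> cmap c ` cdom c"

abbreviation cinv :: "('a, 'e) chart \<Rightarrow> 'e \<Rightarrow> 'a" where
  "cinv c \<equiv> inv_into (cdom c) (cmap c)"

abbreviation transition :: "('a, 'e) chart \<Rightarrow> ('a, 'e) chart \<Rightarrow> 'e \<Rightarrow> 'e" where
  "transition c d \<equiv> cmap d \<circ> cinv c"

definition charts_at :: "('a, 'e) chart set \<Rightarrow> 'a \<Rightarrow> ('a, 'e) chart set" where
  "charts_at A p = {c \<in> A. p \<in> cdom c}"

text \<open>The atlas \<open>A\<close> need not be maximal. The dimension is \<open>DIM('e)\<close>.\<close>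

definition smooth_manifold :: "'a topology \<Rightarrow> ('a, 'e::euclidean_space) chart set \<Rightarrow> bool" where
  "smooth_manifold X A \<longleftrightarrow>
     Hausdorff_space X \<and> second_countable X \<and>
     (\<Union>c\<in>A. cdom c) = topspace X \<and>
     (\<forall>c\<in>A. openin X (cdom c) \<and> open (crange c) \<and>
        homeomorphic_map (subtopology X (cdom c)) (top_of_set (crange c)) (cmap c)) \<and>
     (\<forall>c\<in>A. \<forall>d\<in>A. smooth_on (cmap c ` (cdom c \<inter> cdom d)) (transition c d))"


section \<open>Tangent vectors\<close>

text \<open>
  A tangent vector at \<open>p\<close> is the family of its components in all charts of the atlas around \<open>p\<close>,
  related by the differentials of the transition maps; the components in all other charts are
  set to 0, so that vectors are equal iff they are equal as functions. The vector space operations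
  are pointwise; in particular \<open>u - v\<close> below is the pointwise difference of functions.
\<close>

type_synonym ('a, 'e) tangent = "('a, 'e) chart \<Rightarrow> 'e"

definition tangent_space :: "('a, 'e::euclidean_space) chart set \<Rightarrow> 'a \<Rightarrow> ('a, 'e) tangent set" where
  "tangent_space A p =
     {u. (\<forall>c\<in>charts_at A p. \<forall>d\<in>charts_at A p.
            u d = frechet_derivative (transition c d) (at (cmap c p)) (u c)) \<and>
         (\<forall>c. c \<notin> charts_at A p \<longrightarrow> u c = 0)}"

text \<open>The tangent vector at \<open>p\<close> whose component in the chart \<open>c\<close> is \<open>w\<close>.\<close>

definition tangent_of ::
  "('a, 'e::euclidean_space) chart set \<Rightarrow> ('a, 'e) chart \<Rightarrow> 'a \<Rightarrow> 'e \<Rightarrow> ('a, 'e) tangent" where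
  "tangent_of A c p w =
     (\<lambda>d. if d \<in> charts_at A p then frechet_derivative (transition c d) (at (cmap c p)) w else 0)"


section \<open>Riemannian metrics\<close>

definition inner_product_on ::
  "('a, 'e::euclidean_space) tangent set \<Rightarrow> (('a, 'e) tangent \<Rightarrow> ('a, 'e) tangent \<Rightarrow> real) \<Rightarrow> bool" where
  "inner_product_on V B \<longleftrightarrow>
     (\<forall>u\<in>V. \<forall>v\<in>V. \<forall>w\<in>V. \<forall>a b.
        B (\<lambda>c. a *\<^sub>R u c + b *\<^sub>R v c) w = a * B u w + b * B v w) \<and>
     (\<forall>u\<in>V. \<forall>v\<in>V. B u v = B v u) \<and>
     (\<forall>u\<in>V. u \<noteq> (\<lambda>c. 0) \<longrightarrow> B u u > 0)"

type_synonym ('a, 'e) metric = "'a \<Rightarrow> ('a, 'e) tangent \<Rightarrow> ('a, 'e) tangent \<Rightarrow> real"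

text \<open>The metric in the chart \<open>c\<close>, as a field of bilinear forms on the range of \<open>c\<close>.\<close>

definition metric_in_chart ::
  "('a, 'e::euclidean_space) chart set \<Rightarrow> ('a, 'e) metric \<Rightarrow> ('a, 'e) chart \<Rightarrow> 'e \<Rightarrow> 'e \<Rightarrow> 'e \<Rightarrow> real" where
  "metric_in_chart A g c x v w =
     g (cinv c x) (tangent_of A c (cinv c x) v) (tangent_of A c (cinv c x) w)"

definition riemannian_manifold ::
  "'a topology \<Rightarrow> ('a, 'e::euclidean_space) chart set \<Rightarrow> ('a, 'e) metric \<Rightarrow> bool" where
  "riemannian_manifold X A g \<longleftrightarrow>
     smooth_manifold X A \<and>
     (\<forall>p\<in>topspace X. inner_product_on (tangent_space A p) (g p)) \<and>
     (\<forall>c\<in>A. \<forall>v w. smooth_on (crange c) (\<lambda>x. metric_in_chart A g c x v w))"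

definition tnorm :: "('a, 'e) metric \<Rightarrow> 'a \<Rightarrow> ('a, 'e) tangent \<Rightarrow> real" where
  "tnorm g p u = sqrt (g p u u)"

text \<open>
  In a chart a connection has the form \<open>\<nabla>\<^sub>w Y = D\<^sub>w Y + \<Gamma> w Y\<close> with \<open>\<Gamma>\<close> bilinear at each point.
  It is torsion-free iff \<open>\<Gamma>\<close> is symmetric, and compatible with the metric iff
  \<open>D\<^sub>w (g u v) = g (\<Gamma> w u) v + g u (\<Gamma> w v)\<close> for constant \<open>u\<close>, \<open>v\<close>.
\<close>

definition levi_civita ::
  "('a, 'e::euclidean_space) chart set \<Rightarrow> ('a, 'e) metric \<Rightarrow> ('a, 'e) chart \<Rightarrow> 'e \<Rightarrow> 'e \<Rightarrow> 'e \<Rightarrow> 'e" where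
  "levi_civita A g c x = (THE \<Gamma>.
     bilinear \<Gamma> \<and>
     (\<forall>u v. \<Gamma> u v = \<Gamma> v u) \<and>
     (\<forall>u v w. frechet_derivative (\<lambda>y. metric_in_chart A g c y u v) (at x) w =
        metric_in_chart A g c x (\<Gamma> w u) v + metric_in_chart A g c x u (\<Gamma> w v)))"


section \<open>Curves and parallel translation\<close>

text \<open>Smoothness on \<open>[a, b]\<close> means local extendability to a smooth map on an open interval.\<close>

definition smooth_curve_on ::
  "('a, 'e::euclidean_space) chart set \<Rightarrow> real \<Rightarrow> real \<Rightarrow> (real \<Rightarrow> 'a) \<Rightarrow> bool" where
  "smooth_curve_on A a b \<alpha> \<longleftrightarrow>
     (\<forall>t\<in>{a..b}. \<forall>c\<in>charts_at A (\<alpha> t). \<exists>\<epsilon>>0. \<exists>f.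
        smooth_on {t - \<epsilon><..<t + \<epsilon>} f \<and>
        (\<forall>s\<in>{a..b} \<inter> {t - \<epsilon><..<t + \<epsilon>}. cmap c (\<alpha> s) = f s))"

definition piecewise_smooth_path ::
  "'a topology \<Rightarrow> ('a, 'e::euclidean_space) chart set \<Rightarrow> (real \<Rightarrow> 'a) \<Rightarrow> bool" where
  "piecewise_smooth_path X A \<alpha> \<longleftrightarrow>
     pathin X \<alpha> \<and>
     (\<exists>P. finite P \<and> {0, 1} \<subseteq> P \<and> P \<subseteq> {0..1} \<and>
        (\<forall>a\<in>P. \<forall>b\<in>P. a < b \<and> P \<inter> {a<..<b} = {} \<longrightarrow> smooth_curve_on A a b \<alpha>))"

definition piecewise_smooth_loops ::
  "'a topology \<Rightarrow> ('a, 'e::euclidean_space) chart set \<Rightarrow> 'a \<Rightarrow> (real \<Rightarrow> 'a) set" where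
  "piecewise_smooth_loops X A p = {\<alpha>. piecewise_smooth_path X A \<alpha> \<and> \<alpha> 0 = p \<and> \<alpha> 1 = p}"

definition velocity ::
  "('a, 'e::euclidean_space) chart set \<Rightarrow> (real \<Rightarrow> 'a) \<Rightarrow> real \<Rightarrow> ('a, 'e) tangent" where
  "velocity A \<alpha> t =
     (\<lambda>c. if c \<in> charts_at A (\<alpha> t) then vector_derivative (cmap c \<circ> \<alpha>) (at t) else 0)"

definition curve_length ::
  "('a, 'e::euclidean_space) chart set \<Rightarrow> ('a, 'e) metric \<Rightarrow> (real \<Rightarrow> 'a) \<Rightarrow> real" where
  "curve_length A g \<alpha> = integral {0..1} (\<lambda>t. tnorm g (\<alpha> t) (velocity A \<alpha> t))"

text \<open>
  Continuous vector fields along a piecewise smooth \<open>\<alpha>\<close> that satisfy \<open>\<nabla>\<^sub>\<alpha>\<^sub>' Y = 0\<close> away from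
  finitely many points; the exceptional set \<open>S\<close> accounts for the corners of \<open>\<alpha>\<close>.
\<close>

definition parallel_along ::
  "('a, 'e::euclidean_space) chart set \<Rightarrow> ('a, 'e) metric \<Rightarrow> (real \<Rightarrow> 'a) \<Rightarrow>
    (real \<Rightarrow> ('a, 'e) tangent) \<Rightarrow> bool" where
  "parallel_along A g \<alpha> Y \<longleftrightarrow>
     (\<forall>t\<in>{0..1}. Y t \<in> tangent_space A (\<alpha> t)) \<and>
     (\<forall>t\<in>{0..1}. \<forall>c\<in>charts_at A (\<alpha> t). continuous (at t within {0..1}) (\<lambda>s. Y s c)) \<and>
     (\<exists>S. finite S \<and>
        (\<forall>t\<in>{0<..<1} - S. \<forall>c\<in>charts_at A (\<alpha> t).
           ((\<lambda>s. Y s c) has_vector_derivative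
              - levi_civita A g c (cmap c (\<alpha> t)) (velocity A \<alpha> t c) (Y t c)) (at t)))"

text \<open>
  \<open>a\<close> is the parallel translation \<open>P\<^sup>\<alpha>\<^sub>1\<close> along the loop \<open>\<alpha>\<close> at \<open>p\<close>. Being extensional, \<open>a\<close> is
  determined by its values on the tangent space.
\<close>

definition is_parallel_translation ::
  "('a, 'e::euclidean_space) chart set \<Rightarrow> ('a, 'e) metric \<Rightarrow> 'a \<Rightarrow> (real \<Rightarrow> 'a) \<Rightarrow>
    (('a, 'e) tangent \<Rightarrow> ('a, 'e) tangent) \<Rightarrow> bool" where
  "is_parallel_translation A g p \<alpha> a \<longleftrightarrow>
     a \<in> tangent_space A p \<rightarrow>\<^sub>E tangent_space A p \<and>
     (\<forall>u\<in>tangent_space A p. \<exists>Y. parallel_along A g \<alpha> Y \<and> Y 0 = u \<and> Y 1 = a u)"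


section \<open>Holonomy\<close>

definition holonomy ::
  "'a topology \<Rightarrow> ('a, 'e::euclidean_space) chart set \<Rightarrow> ('a, 'e) metric \<Rightarrow> 'a \<Rightarrow>
    (('a, 'e) tangent \<Rightarrow> ('a, 'e) tangent) set" where
  "holonomy X A g p =
     {a. \<exists>\<alpha>\<in>piecewise_smooth_loops X A p. is_parallel_translation A g p \<alpha> a}"

definition length_norm ::
  "'a topology \<Rightarrow> ('a, 'e::euclidean_space) chart set \<Rightarrow> ('a, 'e) metric \<Rightarrow> 'a \<Rightarrow>
    (('a, 'e) tangent \<Rightarrow> ('a, 'e) tangent) \<Rightarrow> real" where
  "length_norm X A g p a =
     Inf {curve_length A g \<alpha> | \<alpha>.
       \<alpha> \<in> piecewise_smooth_loops X A p \<and> is_parallel_translation A g p \<alpha> a}"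

text \<open>With values in \<open>[0, \<infinity>]\<close>; the supremum of the empty set is 0.\<close>

definition holonomy_radius ::
  "'a topology \<Rightarrow> ('a, 'e::euclidean_space) chart set \<Rightarrow> ('a, 'e) metric \<Rightarrow> 'a \<Rightarrow> ennreal" where
  "holonomy_radius X A g p =
     Sup (ennreal ` {r. r > 0 \<and>
       (\<forall>u\<in>tangent_space A p. \<forall>v\<in>tangent_space A p. \<forall>a\<in>holonomy X A g p.
          tnorm g p u \<le> r \<and> tnorm g p v \<le> r \<longrightarrow>
          (tnorm g p (u - v))\<^sup>2 - (tnorm g p (a u - v))\<^sup>2 \<le> (length_norm X A g p a)\<^sup>2)})"

end

theory Submission
  imports Defs
begin

text \<open>
  For a short loop \<open>\<alpha>\<close> at \<open>p\<close>, which stays in one chart around \<open>p\<close>, and a parallel field \<open>Y\<close>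
  along \<open>\<alpha>\<close>, the curve \<open>Y + \<Gamma>\<^sub>p(\<alpha>, Y 0)\<close> has derivative
  \<open>- (\<Gamma>\<^sub>\<alpha> - \<Gamma>\<^sub>p)(\<alpha>', Y) - \<Gamma>\<^sub>p(\<alpha>', Y - Y 0)\<close> in the chart. Since \<open>\<Gamma>\<close> is Lipschitz at \<open>p\<close>, this is
  bounded by the length of \<open>\<alpha>\<close> times its speed, and the correction term \<open>\<Gamma>\<^sub>p(\<alpha>, Y 0)\<close> takes the
  same value at both ends of the loop. Hence \<open>\<parallel>Y 1 - Y 0\<parallel> \<le> C \<ell>(\<alpha>)\<^sup>2 \<parallel>Y 0\<parallel>\<close>, so the required
  inequality holds for short loops and small \<open>u\<close>, \<open>v\<close>. For the other loops
  \<open>\<parallel>u - v\<parallel>\<^sup>2 \<le> 4 r\<^sup>2\<close> already suffices.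
\<close>

section \<open>Calculus\<close>

text \<open>The difference to be bounded is linear in \<open>u - a u\<close>: it equals
  \<open>g p (u - a u) (u + a u - 2 v)\<close>, while the allowed bound is quadratic in the length.
  A first-order estimate of \<open>u - a u\<close> would therefore not suffice for short loops,
  however small the radius. A second-order one leaves \<open>\<ell>\<^sup>2\<close> times a constant
  times \<open>r\<^sup>2\<close>, and a small radius makes that factor at most 1. Two circularities
  shape the argument. The equation for \<open>Y\<close> bounds its variation only in terms of the
  size of \<open>Y\<close> itself; evaluating at a maximum of the norm resolves this. The bounds on
  the metric and on \<open>\<Gamma>\<close> hold only in a small ball, and that the loop stays there
  is itself a consequence of these bounds; a first exit time resolves this. The connection is given
  by a description, so its existence and uniqueness come before any estimate. Its Lipschitz bound is
  then drawn from the Koszul identity, which involves only the metric and its first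
  derivatives.\<close>

lemma smooth_on_differentiable:
  "smooth_on S f \<Longrightarrow> x \<in> S \<Longrightarrow> f differentiable (at x)"
  unfolding smooth_on_def using Ck_on.simps(2) by blast

lemma smooth_on_frechet_derivative:
  "smooth_on S f \<Longrightarrow> smooth_on S (\<lambda>x. frechet_derivative f (at x) v)"
  unfolding smooth_on_def using Ck_on.simps(2) by blast

lemma smooth_on_continuous_on: "smooth_on S f \<Longrightarrow> continuous_on S f"
  unfolding smooth_on_def using Ck_on.simps(1) by blast

section \<open>Local Lipschitz bounds for families of multilinear maps, and a mean value
  inequality\<close>

lemma differentiable_eventually_bound:
  fixes f :: "'a::real_normed_vector \<Rightarrow> 'b::real_normed_vector"
  assumes "f differentiable (at x0)"
  shows "\<exists>C\<ge>0. \<forall>\<^sub>F x in nhds x0. norm (f x - f x0) \<le> C * norm (x - x0)"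
proof -
  obtain D where D: "(f has_derivative D) (at x0)"
    using assms differentiable_def by blast
  obtain K where K: "\<And>h. norm (D h) \<le> norm h * K" and "0 \<le> K"
    using bounded_linear.nonneg_bounded[OF has_derivative_bounded_linear[OF D]] by blast
  obtain d where "d > 0" and d: "\<And>x. norm (x - x0) < d \<Longrightarrow> norm (f x - f x0 - D (x - x0)) \<le> 1 * norm (x - x0)"
    using D[unfolded has_derivative_at_alt] zero_less_one by blast
  have "norm (f x - f x0) \<le> (K + 1) * norm (x - x0)" if "dist x x0 < d" for x
  proof -
    have "norm (f x - f x0) \<le> norm (f x - f x0 - D (x - x0)) + norm (D (x - x0))"
      by norm
    then show ?thesis
      using d[of x] K[of "x - x0"] that by (simp add: dist_norm algebra_simps)
  qed
  then show ?thesis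
    unfolding eventually_nhds_metric using \<open>d > 0\<close> \<open>0 \<le> K\<close>
    by (intro exI[of _ "K + 1"]) auto
qed

text \<open>The sum of the individual constants dominates each of them, so monotonicity in the
  constant gives one bound for all indices. It is applied to the finitely many basis
  vectors.\<close>

lemma finite_family_eventually_bound:
  fixes P :: "'i \<Rightarrow> real \<Rightarrow> 'a \<Rightarrow> bool"
  assumes "finite I"
    and "\<And>i. i \<in> I \<Longrightarrow> \<exists>C\<ge>0. \<forall>\<^sub>F x in F. P i C x"
    and mono: "\<And>i C D x. P i C x \<Longrightarrow> C \<le> D \<Longrightarrow> P i D x"
  shows "\<exists>C\<ge>0. \<forall>\<^sub>F x in F. \<forall>i\<in>I. P i C x"
proof -
  obtain c where c: "\<And>i. i \<in> I \<Longrightarrow> c i \<ge> 0 \<and> (\<forall>\<^sub>F x in F. P i (c i) x)"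
    using assms(2) by metis
  have le: "c i \<le> sum c I" if "i \<in> I" for i
    using member_le_sum[of i I c] that c assms(1) by auto
  have "\<forall>\<^sub>F x in F. P i (sum c I) x" if "i \<in> I" for i
    using c[OF that] le[OF that] mono by (metis (mono_tags, lifting) eventually_mono)
  then show ?thesis
    using assms(1) c by (intro exI[of _ "sum c I"]) (simp add: eventually_ball_finite sum_nonneg)
qed

lemma linear_bound_from_Basis:
  fixes f :: "'e::euclidean_space \<Rightarrow> 'b::real_normed_vector" and C :: real
  assumes "linear f" and "\<And>b. b \<in> Basis \<Longrightarrow> norm (f b) \<le> C"
  shows "norm (f v) \<le> DIM('e) * C * norm v"
proof -
  have "f v = f (\<Sum>b\<in>Basis. (v \<bullet> b) *\<^sub>R b)"
    by (simp add: euclidean_representation)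
  also have "\<dots> = (\<Sum>b\<in>Basis. (v \<bullet> b) *\<^sub>R f b)"
    by (simp add: linear_sum[OF assms(1)] linear_scale[OF assms(1)])
  also have "norm \<dots> \<le> (\<Sum>b\<in>(Basis::'e set). norm v * C)"
    by (rule order_trans[OF norm_sum sum_mono])
      (auto intro!: mult_mono assms(2) Basis_le_norm)
  finally show ?thesis by (simp add: mult_ac)
qed

text \<open>Differentiability is known only for each fixed \<open>v\<close>. Linearity reduces
  uniformity in \<open>v\<close> to the basis vectors, at the cost of the factor
  \<open>DIM('e)\<close>.\<close>

lemma linear_family_eventually_bound:
  fixes f :: "'a::real_normed_vector \<Rightarrow> 'e::euclidean_space \<Rightarrow> 'b::real_normed_vector"
  assumes lin: "\<forall>\<^sub>F x in nhds x0. linear (f x)" and "\<And>v. (\<lambda>x. f x v) differentiable (at x0)"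
  shows "\<exists>C\<ge>0. \<forall>\<^sub>F x in nhds x0. \<forall>v. norm (f x v - f x0 v) \<le> C * norm (x - x0) * norm v"
proof -
  obtain C where "C \<ge> 0" and
    C: "\<forall>\<^sub>F x in nhds x0. \<forall>b\<in>Basis. norm (f x b - f x0 b) \<le> C * norm (x - x0)"
    using finite_family_eventually_bound[of Basis "\<lambda>b C x. norm (f x b - f x0 b) \<le> C * norm (x - x0)"]
      differentiable_eventually_bound[OF assms(2)]
    by (meson finite_Basis mult_right_mono norm_ge_zero order_trans)
  have "\<forall>\<^sub>F x in nhds x0. \<forall>v. norm (f x v - f x0 v) \<le> (DIM('e) * C) * norm (x - x0) * norm v"
    using C lin
  proof eventually_elim
    case (elim x)
    show ?case
    proof
      fix v
      have "linear (f x0)" using lin eventually_nhds_x_imp_x by metis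
      then show "norm (f x v - f x0 v) \<le> (DIM('e) * C) * norm (x - x0) * norm v"
        using linear_bound_from_Basis[of "\<lambda>v. f x v - f x0 v" "C * norm (x - x0)" v] elim
        by (simp add: linear_compose_sub mult.assoc)
    qed
  qed
  with \<open>C \<ge> 0\<close> show ?thesis by (intro exI[of _ "DIM('e) * C"]) auto
qed

text \<open>One argument is peeled off: for \<open>u\<close> in the basis the linear case applies in
  \<open>v\<close>, and linearity in \<open>u\<close> does the rest.\<close>

lemma bilinear_family_eventually_bound:
  fixes f :: "'a::real_normed_vector \<Rightarrow> 'e::euclidean_space \<Rightarrow> 'e2::euclidean_space \<Rightarrow> 'b::real_normed_vector"
  assumes lin: "\<forall>\<^sub>F x in nhds x0. bilinear (f x)"
    and diff: "\<And>u v. (\<lambda>x. f x u v) differentiable (at x0)"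
  shows "\<exists>C\<ge>0. \<forall>\<^sub>F x in nhds x0. \<forall>u v. norm (f x u v - f x0 u v) \<le> C * norm (x - x0) * norm u * norm v"
proof -
  have "\<exists>C\<ge>0. \<forall>\<^sub>F x in nhds x0. \<forall>v. norm (f x b v - f x0 b v) \<le> C * norm (x - x0) * norm v" for b
    by (rule linear_family_eventually_bound[OF eventually_mono[OF lin] diff]) (simp add: bilinear_def)
  then have "\<exists>C\<ge>0. \<forall>\<^sub>F x in nhds x0. \<forall>b\<in>Basis. \<forall>v. norm (f x b v - f x0 b v) \<le> C * norm (x - x0) * norm v"
    by (intro finite_family_eventually_bound) (auto, blast intro: order_trans mult_right_mono norm_ge_zero)
  then obtain C where "C \<ge> 0" and
    C: "\<forall>\<^sub>F x in nhds x0. \<forall>b\<in>Basis. \<forall>v. norm (f x b v - f x0 b v) \<le> C * norm (x - x0) * norm v"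
    by blast
  have "\<forall>\<^sub>F x in nhds x0. \<forall>u v. norm (f x u v - f x0 u v) \<le> (DIM('e) * C) * norm (x - x0) * norm u * norm v"
    using C lin
  proof eventually_elim
    case (elim x)
    show ?case
    proof (intro allI)
      fix u v
      have "bilinear (f x0)" using lin eventually_nhds_x_imp_x by metis
      then have "linear (\<lambda>u. f x u v - f x0 u v)"
        using elim by (auto simp: bilinear_def intro: linear_compose_sub)
      then show "norm (f x u v - f x0 u v) \<le> (DIM('e) * C) * norm (x - x0) * norm u * norm v"
        using linear_bound_from_Basis[of "\<lambda>u. f x u v - f x0 u v" "C * norm (x - x0) * norm v" u] elim
        by (simp add: mult_ac)
    qed
  qed
  with \<open>C \<ge> 0\<close> show ?thesis by (intro exI[of _ "DIM('e) * C"]) auto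
qed

text \<open>The same reduction once more; three arguments occur in the Koszul combination of
  derivatives of the metric.\<close>

lemma trilinear_family_eventually_bound:
  fixes f :: "'a::real_normed_vector \<Rightarrow> 'e1::euclidean_space \<Rightarrow> 'e2::euclidean_space \<Rightarrow> 'e3::euclidean_space
    \<Rightarrow> 'b::real_normed_vector"
  assumes lin: "\<forall>\<^sub>F x in nhds x0. \<forall>w. bilinear (f x w)"
    and lin': "\<forall>\<^sub>F x in nhds x0. \<forall>u v. linear (\<lambda>w. f x w u v)"
    and diff: "\<And>w u v. (\<lambda>x. f x w u v) differentiable (at x0)"
  shows "\<exists>C\<ge>0. \<forall>\<^sub>F x in nhds x0. \<forall>w u v.
    norm (f x w u v - f x0 w u v) \<le> C * norm (x - x0) * norm w * norm u * norm v"
proof -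
  have "\<exists>C\<ge>0. \<forall>\<^sub>F x in nhds x0. \<forall>u v. norm (f x b u v - f x0 b u v) \<le> C * norm (x - x0) * norm u * norm v" for b
    by (rule bilinear_family_eventually_bound[OF eventually_mono[OF lin] diff]) simp
  then have "\<exists>C\<ge>0. \<forall>\<^sub>F x in nhds x0. \<forall>b\<in>Basis. \<forall>u v. norm (f x b u v - f x0 b u v) \<le> C * norm (x - x0) * norm u * norm v"
    by (intro finite_family_eventually_bound) (auto, blast intro: order_trans mult_right_mono norm_ge_zero)
  then obtain C where "C \<ge> 0" and
    C: "\<forall>\<^sub>F x in nhds x0. \<forall>b\<in>Basis. \<forall>u v. norm (f x b u v - f x0 b u v) \<le> C * norm (x - x0) * norm u * norm v"
    by blast
  have "\<forall>\<^sub>F x in nhds x0. \<forall>w u v.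
    norm (f x w u v - f x0 w u v) \<le> (DIM('e1) * C) * norm (x - x0) * norm w * norm u * norm v"
    using C lin'
  proof eventually_elim
    case (elim x)
    show ?case
    proof (intro allI)
      fix w u v
      have "linear (\<lambda>w. f x0 w u v)" using lin' eventually_nhds_x_imp_x by fast
      then have "linear (\<lambda>w. f x w u v - f x0 w u v)"
        using elim by (auto intro: linear_compose_sub)
      then show "norm (f x w u v - f x0 w u v) \<le> (DIM('e1) * C) * norm (x - x0) * norm w * norm u * norm v"
        using linear_bound_from_Basis[of "\<lambda>w. f x w u v - f x0 w u v" "C * norm (x - x0) * norm u * norm v" w] elim
        by (simp add: mult_ac)
    qed
  qed
  with \<open>C \<ge> 0\<close> show ?thesis by (intro exI[of _ "DIM('e1) * C"]) auto
qed

text \<open>The fundamental theorem of calculus tolerates a finite exceptional set for continuous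
  \<open>f\<close>. This set will hold the corners of the curve.\<close>

lemma norm_diff_le_integral:
  fixes f :: "real \<Rightarrow> 'b::euclidean_space"
  assumes "a \<le> b" "finite S" "continuous_on {a..b} f"
    and der: "\<And>t. t \<in> {a<..<b} - S \<Longrightarrow> (f has_vector_derivative f' t) (at t)"
    and le: "\<And>t. t \<in> {a<..<b} - S \<Longrightarrow> norm (f' t) \<le> h t"
    and "h integrable_on {a..b}" and "\<And>t. t \<in> {a..b} \<Longrightarrow> 0 \<le> h t"
  shows "norm (f b - f a) \<le> integral {a..b} h"
proof -
  \<comment> \<open>With the value 0 at the exceptional points the bound by \<open>h\<close> holds
    on the whole interval, because \<open>h\<close> is nonnegative.\<close>
  define f'' where "f'' t = (if t \<in> {a<..<b} - S then f' t else 0)" for t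
  have hi: "(f'' has_integral (f b - f a)) {a..b}"
    by (rule fundamental_theorem_of_calculus_interior_strong[OF assms(2,1) _ assms(3)])
      (use der in \<open>auto simp: f''_def\<close>)
  have "norm (integral {a..b} f'') \<le> integral {a..b} h"
    using hi assms(6) by (intro integral_norm_bound_integral) (use le assms(7) in \<open>auto simp: f''_def\<close>)
  then show ?thesis using integral_unique[OF hi] by simp
qed

section \<open>The Levi-Civita connection in a chart\<close>

definition pos_def_form :: "('e::euclidean_space \<Rightarrow> 'e \<Rightarrow> real) \<Rightarrow> bool" where
  "pos_def_form G \<longleftrightarrow> bilinear G \<and> (\<forall>u v. G u v = G v u) \<and> (\<forall>v. v \<noteq> 0 \<longrightarrow> G v v > 0)"

text \<open>The minimum of \<open>G v v\<close> on the compact unit sphere is positive; scaling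
  extends it to all vectors.\<close>

lemma pos_def_form_coercive:
  fixes G :: "'e::euclidean_space \<Rightarrow> 'e \<Rightarrow> real"
  assumes "pos_def_form G"
  shows "\<exists>k>0. \<forall>v. k * (norm v)\<^sup>2 \<le> G v v"
proof -
  have bil: "bilinear G" and pos: "\<And>v. v \<noteq> 0 \<Longrightarrow> G v v > 0"
    using assms by (auto simp: pos_def_form_def)
  interpret bounded_bilinear G using bil bilinear_conv_bounded_bilinear by blast
  have "continuous_on (sphere 0 1) (\<lambda>v. G v v)"
    by (intro continuous_on continuous_on_id)
  then obtain e where e: "e \<in> sphere 0 1" and min: "\<And>v. v \<in> sphere 0 1 \<Longrightarrow> G e e \<le> G v v"
    using continuous_attains_inf[of "sphere 0 1" "\<lambda>v. G v v"] by auto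
  have "G e e * (norm v)\<^sup>2 \<le> G v v" for v
  proof (cases "v = 0")
    case False
    have "G e e \<le> G (v /\<^sub>R norm v) (v /\<^sub>R norm v)"
      using False by (intro min) simp
    also have "\<dots> = G v v / (norm v)\<^sup>2"
      by (simp add: scaleR_left scaleR_right power2_eq_square field_simps)
    finally show ?thesis using False by (simp add: field_simps)
  qed (simp add: zero_left)
  moreover have "G e e > 0" using e by (intro pos) auto
  ultimately show ?thesis by blast
qed

text \<open>Testing with \<open>v = y - z\<close> gives \<open>G (y - z) (y - z) = 0\<close>.
  Identities between vectors that are known only through \<open>G\<close> are proved this
  way.\<close>

lemma pos_def_form_eqI:
  assumes "pos_def_form G" and "\<And>v. G y v = G z v"
  shows "y = z"
proof -
  have "bilinear G" using assms(1) by (simp add: pos_def_form_def)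
  then have "G (y - z) (y - z) = 0"
    by (simp only: bilinear_lsub assms(2) diff_self)
  then show ?thesis
    using assms(1) by (metis eq_iff_diff_eq_0 less_irrefl pos_def_form_def)
qed

text \<open>The Gram map \<open>T\<close>, with \<open>G z v = T z \<bullet> v\<close>, is injective
  by nondegeneracy, hence surjective in finite dimension. A preimage of the Euclidean representative
  of \<open>f\<close> represents \<open>f\<close> for \<open>G\<close>.\<close>

lemma pos_def_form_riesz:
  fixes G :: "'e::euclidean_space \<Rightarrow> 'e \<Rightarrow> real"
  assumes "pos_def_form G" and "linear f"
  shows "\<exists>z. \<forall>v. G z v = f v"
proof -
  have bil: "bilinear G" using assms(1) by (simp add: pos_def_form_def)
  define T where "T z = (\<Sum>b\<in>Basis. G z b *\<^sub>R b)" for z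
  have rep: "h v = (\<Sum>b\<in>Basis. h b *\<^sub>R b) \<bullet> v" if "linear h" for h :: "'e \<Rightarrow> real" and v
  proof -
    have "h v = h (\<Sum>b\<in>Basis. (v \<bullet> b) *\<^sub>R b)" by (simp add: euclidean_representation)
    also have "\<dots> = (\<Sum>b\<in>Basis. h b *\<^sub>R b) \<bullet> v"
      by (simp add: linear_sum[OF that] linear_scale[OF that] inner_sum_left inner_sum_right inner_commute mult.commute)
    finally show ?thesis .
  qed
  have GT: "G z v = T z \<bullet> v" for z v
    using rep[of "G z" v] bil by (simp add: T_def bilinear_def)
  have "linear T"
    unfolding T_def
    by (rule linearI) (simp_all add: bilinear_ladd[OF bil] bilinear_lmul[OF bil] scaleR_add_left sum.distrib scaleR_sum_right)
  moreover have "inj T"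
    by (rule injI) (auto intro: pos_def_form_eqI[OF assms(1)] simp: GT)
  ultimately have "surj T" using linear_injective_imp_surjective by blast
  then obtain z where "T z = (\<Sum>b\<in>Basis. f b *\<^sub>R b)" by (metis surjD)
  then show ?thesis using GT rep[OF assms(2)] by metis
qed

text \<open>The conditions inside \<open>levi_civita\<close>, detached from the manifold:
  \<open>D w u v\<close> stands for the derivative of the metric coefficient of \<open>u\<close>,
  \<open>v\<close> in direction \<open>w\<close>.\<close>

definition torsion_free_metric ::
  "('e::euclidean_space \<Rightarrow> 'e \<Rightarrow> real) \<Rightarrow> ('e \<Rightarrow> 'e \<Rightarrow> 'e \<Rightarrow> real) \<Rightarrow> ('e \<Rightarrow> 'e \<Rightarrow> 'e) \<Rightarrow> bool" where
  "torsion_free_metric G D \<Gamma> \<longleftrightarrow> bilinear \<Gamma> \<and> (\<forall>u v. \<Gamma> u v = \<Gamma> v u) \<and>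
     (\<forall>u v w. D w u v = G (\<Gamma> w u) v + G u (\<Gamma> w v))"

text \<open>In the signed sum of three instances of metric compatibility, symmetry of
  \<open>G\<close> and of \<open>\<Gamma>\<close> cancels everything except two equal terms. The
  formula yields uniqueness of \<open>\<Gamma>\<close> and later its Lipschitz bound.\<close>

lemma koszul:
  assumes "pos_def_form G" "torsion_free_metric G D \<Gamma>"
  shows "2 * G (\<Gamma> w u) v = D w u v + D u w v - D v w u"
proof -
  have "G x y = G y x" "\<Gamma> x y = \<Gamma> y x" for x y
    using assms by (auto simp: pos_def_form_def torsion_free_metric_def)
  moreover have "D x y z = G (\<Gamma> x y) z + G y (\<Gamma> x z)" for x y z
    using assms by (auto simp: torsion_free_metric_def)
  ultimately show ?thesis by (smt (verit))
qed

text \<open>Half the right-hand side of the Koszul formula is linear in \<open>v\<close>, so it is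
  represented by a vector \<open>\<Gamma> w u\<close>. Bilinearity, symmetry and compatibility are
  then checked by pairing with \<open>G\<close>.\<close>

lemma torsion_free_metric_ex1:
  assumes G: "pos_def_form G"
    and D: "\<And>w. bilinear (D w)" "\<And>u v. linear (\<lambda>w. D w u v)" "\<And>w u v. D w u v = D w v u"
  shows "\<exists>!\<Gamma>. torsion_free_metric G D \<Gamma>"
proof -
  have sym: "G x y = G y x" and bil: "bilinear G" for x y
    using G by (auto simp: pos_def_form_def)
  define K where "K w u v = (D w u v + D u w v - D v w u) / 2" for w u v
  note Dlin = bilinear_ladd[OF D(1)] bilinear_lmul[OF D(1)] bilinear_radd[OF D(1)] bilinear_rmul[OF D(1)]
    linear_add[OF D(2)] linear_scale[OF D(2)]
  have "linear (K w u)" for w u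
    by (rule linearI) (simp_all add: K_def Dlin field_simps)
  then have "\<forall>w u. \<exists>z. \<forall>v. G z v = K w u v"
    using pos_def_form_riesz[OF G] by blast
  then obtain \<Gamma> where \<Gamma>: "\<And>w u v. G (\<Gamma> w u) v = K w u v"
    by metis
  note Glin = bilinear_ladd[OF bil] bilinear_lmul[OF bil]
  have "linear (\<Gamma> w)" for w
    by (intro linearI pos_def_form_eqI[OF G]) (simp_all only: Glin \<Gamma>, simp_all add: K_def Dlin field_simps)
  moreover have "linear (\<lambda>w. \<Gamma> w u)" for u
    by (intro linearI pos_def_form_eqI[OF G]) (simp_all only: Glin \<Gamma>, simp_all add: K_def Dlin field_simps)
  ultimately have "bilinear \<Gamma>" by (simp add: bilinear_def)
  moreover have "\<Gamma> u v = \<Gamma> v u" for u v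
    by (rule pos_def_form_eqI[OF G]) (simp add: \<Gamma> K_def D(3)[of _ u v])
  moreover have "D w u v = G (\<Gamma> w u) v + G u (\<Gamma> w v)" for w u v
    by (simp add: sym[of u] \<Gamma> K_def D(3)[of w u v] D(3)[of v u w] field_simps)
  ultimately have "torsion_free_metric G D \<Gamma>" by (simp add: torsion_free_metric_def)
  moreover have "\<Gamma>1 = \<Gamma>2" if "torsion_free_metric G D \<Gamma>1" "torsion_free_metric G D \<Gamma>2" for \<Gamma>1 \<Gamma>2
  proof (intro ext pos_def_form_eqI[OF G])
    fix w u v
    show "G (\<Gamma>1 w u) v = G (\<Gamma>2 w u) v"
      using koszul[OF G that(1), of w u v] koszul[OF G that(2), of w u v] by simp
  qed
  ultimately show ?thesis by blast
qed

section \<open>Metrics on open subsets of Euclidean space and local bounds on their Christoffel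
  symbols\<close>

definition riemannian_metric_on :: "'e::euclidean_space set \<Rightarrow> ('e \<Rightarrow> 'e \<Rightarrow> 'e \<Rightarrow> real) \<Rightarrow> bool" where
  "riemannian_metric_on U G \<longleftrightarrow>
     open U \<and> (\<forall>x\<in>U. pos_def_form (G x)) \<and> (\<forall>u v. smooth_on U (\<lambda>x. G x u v))"

definition metric_deriv ::
  "('e::euclidean_space \<Rightarrow> 'e \<Rightarrow> 'e \<Rightarrow> real) \<Rightarrow> 'e \<Rightarrow> 'e \<Rightarrow> 'e \<Rightarrow> 'e \<Rightarrow> real" where
  "metric_deriv G x w u v = frechet_derivative (\<lambda>y. G y u v) (at x) w"

context
  fixes U :: "'e::euclidean_space set" and G
  assumes metric: "riemannian_metric_on U G"
begin

lemma metric_has_derivative: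
  "x \<in> U \<Longrightarrow> ((\<lambda>y. G y u v) has_derivative (\<lambda>w. metric_deriv G x w u v)) (at x)"
  using metric smooth_on_differentiable frechet_derivative_works
  unfolding riemannian_metric_on_def metric_deriv_def by fast

text \<open>Symmetry and linearity of \<open>G\<close> are known only inside \<open>U\<close>. Since
  \<open>U\<close> is open, identities there still pass to the derivative.\<close>

lemma metric_deriv_eqI:
  assumes "x \<in> U" and "(f has_derivative f') (at x)" and "\<And>y. y \<in> U \<Longrightarrow> f y = G y u v"
  shows "metric_deriv G x w u v = f' w"
proof -
  have "((\<lambda>y. G y u v) has_derivative f') (at x)"
    using metric assms(3)
    by (intro has_derivative_transform_within_open[OF assms(2) _ assms(1)]) (auto simp: riemannian_metric_on_def)
  from has_derivative_unique[OF metric_has_derivative[OF assms(1)] this] show ?thesis by metis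
qed

lemma metric_bilinear: "y \<in> U \<Longrightarrow> bilinear (G y)"
  and metric_sym: "y \<in> U \<Longrightarrow> G y u v = G y v u"
  using metric unfolding riemannian_metric_on_def pos_def_form_def by blast+

lemma metric_deriv_linear:
  assumes "x \<in> U"
  shows "linear (\<lambda>w. metric_deriv G x w u v)"
  using metric_has_derivative[OF assms] has_derivative_linear by blast

lemma metric_deriv_sym:
  assumes "x \<in> U"
  shows "metric_deriv G x w u v = metric_deriv G x w v u"
  by (rule metric_deriv_eqI[OF assms metric_has_derivative[OF assms] metric_sym])

lemma metric_deriv_bilinear:
  assumes "x \<in> U"
  shows "bilinear (metric_deriv G x w)"
proof -
  have lin: "linear (\<lambda>u. metric_deriv G x w u v)" for v
  proof (rule linearI)
    show "metric_deriv G x w (a + b) v = metric_deriv G x w a v + metric_deriv G x w b v" for a b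
      by (rule metric_deriv_eqI[OF assms
            has_derivative_add[OF metric_has_derivative[OF assms] metric_has_derivative[OF assms]]])
        (simp add: bilinear_ladd[OF metric_bilinear])
    show "metric_deriv G x w (r *\<^sub>R a) v = r *\<^sub>R metric_deriv G x w a v" for r a
      by (rule metric_deriv_eqI[OF assms
            has_derivative_scaleR_right[OF metric_has_derivative[OF assms]]])
        (simp add: bilinear_lmul[OF metric_bilinear])
  qed
  show ?thesis
    unfolding bilinear_def using lin by (simp add: metric_deriv_sym[OF assms, of w v for v])
qed

lemma metric_deriv_differentiable:
  assumes "x \<in> U"
  shows "(\<lambda>y. metric_deriv G y w u v) differentiable (at x)"
  unfolding metric_deriv_def
  using metric assms smooth_on_frechet_derivative smooth_on_differentiable
  unfolding riemannian_metric_on_def by fast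

lemma torsion_free_metric_ex1_on:
  assumes "x \<in> U"
  shows "\<exists>!\<Gamma>. torsion_free_metric (G x) (metric_deriv G x) \<Gamma>"
  using metric assms
  by (intro torsion_free_metric_ex1 metric_deriv_bilinear metric_deriv_linear metric_deriv_sym)
    (auto simp: riemannian_metric_on_def)

text \<open>Koszul's formula expresses \<open>G x (\<Gamma> x w u)\<close> through the first
  derivatives of \<open>G\<close>. Differentiability of \<open>G\<close> and of these derivatives at
  \<open>x0\<close> thus passes to a Lipschitz bound on \<open>\<Gamma>\<close>, with coercivity
  serving to remove \<open>G\<close> again.\<close>

lemma christoffel_local_bounds:
  assumes \<Gamma>: "\<And>x. x \<in> U \<Longrightarrow> torsion_free_metric (G x) (metric_deriv G x) (\<Gamma> x)" and "x0 \<in> U"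
  shows "\<exists>k>0. \<exists>\<rho>>0. \<exists>C\<ge>0. cball x0 \<rho> \<subseteq> U \<and> (\<forall>x\<in>cball x0 \<rho>.
    (\<forall>v. k\<^sup>2 * (norm v)\<^sup>2 \<le> G x v v) \<and>
    (\<forall>w u. norm (\<Gamma> x w u) \<le> C * norm w * norm u) \<and>
    (\<forall>w u. norm (\<Gamma> x w u - \<Gamma> x0 w u) \<le> C * norm (x - x0) * norm w * norm u))"
proof -
  \<comment> \<open>The right-hand side of the Koszul formula, hence
    \<open>2 * G x (\<Gamma> x w u) v\<close> for \<open>x\<close> in \<open>U\<close>.\<close>
  define K where "K x w u v = metric_deriv G x w u v + metric_deriv G x u w v - metric_deriv G x v w u" for x w u v
  have inU: "\<forall>\<^sub>F x in nhds x0. x \<in> U"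
    using metric \<open>x0 \<in> U\<close> unfolding riemannian_metric_on_def by (simp add: eventually_nhds_in_open)
  have pd: "pos_def_form (G x)" if "x \<in> U" for x
    using metric that unfolding riemannian_metric_on_def by blast
  obtain k0 where "k0 > 0" and k0: "\<And>v. k0 * (norm v)\<^sup>2 \<le> G x0 v v"
    using pos_def_form_coercive[OF pd[OF \<open>x0 \<in> U\<close>]] by blast
  have "\<exists>C\<ge>0. \<forall>\<^sub>F x in nhds x0. \<forall>u v. norm (G x u v - G x0 u v) \<le> C * norm (x - x0) * norm u * norm v"
    by (rule bilinear_family_eventually_bound[OF eventually_mono[OF inU metric_bilinear]
          differentiableI[OF metric_has_derivative[OF \<open>x0 \<in> U\<close>]]])
  then obtain C1 where "C1 \<ge> 0" and
    C1: "\<forall>\<^sub>F x in nhds x0. \<forall>u v. norm (G x u v - G x0 u v) \<le> C1 * norm (x - x0) * norm u * norm v"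
    by blast
  have Klin: "bilinear (K x w)" "linear (\<lambda>w. K x w u v)" if "x \<in> U" for x w u v
  proof -
    note D = metric_deriv_bilinear[OF that, unfolded bilinear_def] metric_deriv_linear[OF that]
    show "bilinear (K x w)"
      unfolding bilinear_def K_def using D by (auto intro!: linear_compose_sub linear_compose_add)
    show "linear (\<lambda>w. K x w u v)"
      unfolding K_def using D by (auto intro!: linear_compose_sub linear_compose_add)
  qed
  have "\<exists>C\<ge>0. \<forall>\<^sub>F x in nhds x0. \<forall>w u v.
    norm (K x w u v - K x0 w u v) \<le> C * norm (x - x0) * norm w * norm u * norm v"
  proof (rule trilinear_family_eventually_bound)
    show "(\<lambda>x. K x w u v) differentiable (at x0)" for w u v
      unfolding K_def using metric_deriv_differentiable[OF \<open>x0 \<in> U\<close>]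
      by (intro differentiable_diff differentiable_add)
  qed (use inU Klin in \<open>auto elim!: eventually_mono\<close>)
  then obtain C2 where "C2 \<ge> 0" and C2: "\<forall>\<^sub>F x in nhds x0. \<forall>w u v.
    norm (K x w u v - K x0 w u v) \<le> C2 * norm (x - x0) * norm w * norm u * norm v" by blast
  have "bilinear (\<Gamma> x0)" using \<Gamma>[OF \<open>x0 \<in> U\<close>] unfolding torsion_free_metric_def by blast
  then obtain C3 where "C3 > 0" and C3: "\<And>w u. norm (\<Gamma> x0 w u) \<le> C3 * norm w * norm u"
    using bilinear_bounded_pos by blast
  \<comment> \<open>The second bound keeps the change of \<open>G\<close> below half its coercivity
    constant, with \<open>C1 + 1\<close> guarding against division by 0. The bound 1 turns the
    Lipschitz estimate for \<open>\<Gamma>\<close> into a plain bound.\<close>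
  have "\<forall>\<^sub>F x in nhds x0. norm (x - x0) < min 1 (k0 / (2 * (C1 + 1)))"
    using \<open>k0 > 0\<close> \<open>C1 \<ge> 0\<close> eventually_nhds_ball[of "min 1 (k0 / (2 * (C1 + 1)))" x0]
    by (auto elim!: eventually_mono simp: dist_norm norm_minus_commute)
  with inU C1 C2 have "\<forall>\<^sub>F x in nhds x0. x \<in> U \<and> norm (x - x0) < min 1 (k0 / (2 * (C1 + 1))) \<and>
      (\<forall>u v. norm (G x u v - G x0 u v) \<le> C1 * norm (x - x0) * norm u * norm v) \<and>
      (\<forall>w u v. norm (K x w u v - K x0 w u v) \<le> C2 * norm (x - x0) * norm w * norm u * norm v)"
    by eventually_elim auto
  then obtain d where "d > 0" and d: "\<And>x. dist x x0 < d \<Longrightarrow> x \<in> U \<and> norm (x - x0) < min 1 (k0 / (2 * (C1 + 1))) \<and>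
      (\<forall>u v. norm (G x u v - G x0 u v) \<le> C1 * norm (x - x0) * norm u * norm v) \<and>
      (\<forall>w u v. norm (K x w u v - K x0 w u v) \<le> C2 * norm (x - x0) * norm w * norm u * norm v)"
    unfolding eventually_nhds_metric by blast
  \<comment> \<open>Read off from the estimate below,
    \<open>k0 * (norm z)\<^sup>2 \<le> (C2 + 2 * C1 * C3) * N * norm z\<close> for the difference
    \<open>z\<close> of the two Christoffel terms.\<close>
  define C4 where "C4 = (C2 + 2 * C1 * C3) / k0"
  have k0C4: "k0 * C4 = C2 + 2 * C1 * C3" unfolding C4_def using \<open>k0 > 0\<close> by simp
  have "C4 \<ge> 0" unfolding C4_def using \<open>k0 > 0\<close> \<open>C1 \<ge> 0\<close> \<open>C2 \<ge> 0\<close> \<open>C3 > 0\<close> by simp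
  have main: "x \<in> U \<and> (\<forall>v. (k0 / 2) * (norm v)\<^sup>2 \<le> G x v v) \<and>
    (\<forall>w u. norm (\<Gamma> x w u) \<le> (C3 + C4) * norm w * norm u) \<and>
    (\<forall>w u. norm (\<Gamma> x w u - \<Gamma> x0 w u) \<le> (C3 + C4) * norm (x - x0) * norm w * norm u)"
    if "dist x x0 < d" for x
  proof -
    have xU: "x \<in> U" and x1: "norm (x - x0) < 1" and x2: "norm (x - x0) < k0 / (2 * (C1 + 1))"
      and GG: "\<And>u v. \<bar>G x u v - G x0 u v\<bar> \<le> C1 * norm (x - x0) * norm u * norm v"
      and KK: "\<And>w u v. \<bar>K x w u v - K x0 w u v\<bar> \<le> C2 * norm (x - x0) * norm w * norm u * norm v"
      using d[OF that] by auto
    have "C1 * norm (x - x0) \<le> (C1 + 1) * norm (x - x0)" by (simp add: mult_right_mono)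
    also have "\<dots> \<le> k0 / 2"
      using x2 \<open>C1 \<ge> 0\<close> by (simp add: field_simps)
    finally have C1k: "C1 * norm (x - x0) \<le> k0 / 2" .
    have coer: "(k0 / 2) * (norm v)\<^sup>2 \<le> G x v v" for v
    proof -
      have "k0 * (norm v)\<^sup>2 - C1 * norm (x - x0) * (norm v)\<^sup>2 \<le> G x v v"
        using k0[of v] GG[of v v] by (simp add: power2_eq_square mult.assoc)
      moreover have "C1 * norm (x - x0) * (norm v)\<^sup>2 \<le> k0 / 2 * (norm v)\<^sup>2"
        by (intro mult_right_mono C1k) simp
      ultimately show ?thesis by simp
    qed
    have lip: "norm (\<Gamma> x w u - \<Gamma> x0 w u) \<le> C4 * norm (x - x0) * norm w * norm u" for w u
    proof -
      define z where "z = \<Gamma> x w u - \<Gamma> x0 w u"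
      define N where "N = norm (x - x0) * norm w * norm u"
      have "N \<ge> 0" by (simp add: N_def)
      \<comment> \<open>Pairing the difference \<open>z\<close> with itself and inserting the Koszul
        formula at \<open>x\<close> and at \<open>x0\<close> leaves only increments of
        \<open>K\<close> and of \<open>G\<close>, the latter evaluated on the fixed
        \<open>\<Gamma> x0\<close>.\<close>
      have "2 * G x z z = 2 * G x (\<Gamma> x w u) z - 2 * G x (\<Gamma> x0 w u) z"
        by (simp add: z_def bilinear_lsub[OF metric_bilinear[OF xU]] algebra_simps)
      also have "\<dots> = (K x w u z - K x0 w u z) - 2 * (G x (\<Gamma> x0 w u) z - G x0 (\<Gamma> x0 w u) z)"
        using koszul[OF pd[OF xU] \<Gamma>[OF xU], of w u z] koszul[OF pd[OF \<open>x0 \<in> U\<close>] \<Gamma>[OF \<open>x0 \<in> U\<close>], of w u z]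
        by (simp add: K_def)
      also have "\<dots> \<le> C2 * norm (x - x0) * norm w * norm u * norm z
          + 2 * (C1 * norm (x - x0) * norm (\<Gamma> x0 w u) * norm z)"
      proof -
        have "a - 2 * b \<le> A + 2 * B" if "\<bar>a\<bar> \<le> A" "\<bar>b\<bar> \<le> B" for a b A B :: real
          using that by linarith
        then show ?thesis using KK GG by blast
      qed
      also have "\<dots> \<le> C2 * norm (x - x0) * norm w * norm u * norm z
          + 2 * (C1 * norm (x - x0) * (C3 * norm w * norm u) * norm z)"
        using \<open>C1 \<ge> 0\<close> C3[of w u] by (intro add_left_mono mult_left_mono mult_right_mono) auto
      also have "\<dots> = (k0 * C4) * N * norm z"
        by (simp only: k0C4) (simp add: N_def algebra_simps)
      finally have "k0 * (norm z)\<^sup>2 \<le> (k0 * C4) * N * norm z"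
        using coer[of z] by simp
      then have "norm z * norm z \<le> (C4 * N) * norm z"
        using \<open>k0 > 0\<close> by (simp add: power2_eq_square mult.assoc)
      then have "norm z \<le> C4 * N"
        using \<open>C4 \<ge> 0\<close> \<open>N \<ge> 0\<close> by (cases "z = 0") auto
      then show ?thesis by (simp add: z_def N_def mult.assoc)
    qed
    have "norm (\<Gamma> x w u) \<le> (C3 + C4) * norm w * norm u" for w u
    proof -
      have "norm (\<Gamma> x w u) \<le> norm (\<Gamma> x0 w u) + norm (\<Gamma> x w u - \<Gamma> x0 w u)"
        by norm
      also have "\<dots> \<le> C3 * norm w * norm u + C4 * norm (x - x0) * norm w * norm u"
        by (intro add_mono C3 lip)
      also have "\<dots> \<le> C3 * norm w * norm u + C4 * 1 * norm w * norm u"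
        using x1 \<open>C4 \<ge> 0\<close> by (intro add_left_mono mult_left_mono mult_right_mono) auto
      finally show ?thesis by (simp add: algebra_simps)
    qed
    moreover have "norm (\<Gamma> x w u - \<Gamma> x0 w u) \<le> (C3 + C4) * norm (x - x0) * norm w * norm u" for w u
    proof -
      have "C4 * norm (x - x0) * norm w * norm u \<le> (C3 + C4) * norm (x - x0) * norm w * norm u"
        using \<open>C3 > 0\<close> by (intro mult_right_mono) auto
      with lip[of w u] show ?thesis by linarith
    qed
    ultimately show ?thesis using coer xU by blast
  qed
  show ?thesis
  proof (intro exI conjI ballI)
    \<comment> \<open>The root is taken because \<open>k\<close> will compare norms with speeds,
      which are themselves roots of \<open>G v v\<close>. Half of \<open>d\<close> puts the closed
      ball inside the open one.\<close>
    show "sqrt (k0 / 2) > 0" "d / 2 > 0" "C3 + C4 \<ge> 0"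
      using \<open>k0 > 0\<close> \<open>d > 0\<close> \<open>C3 > 0\<close> \<open>C4 \<ge> 0\<close> by auto
    show "cball x0 (d / 2) \<subseteq> U"
      using main \<open>d > 0\<close> by (auto simp: dist_commute)
  next
    fix x assume "x \<in> cball x0 (d / 2)"
    then have "dist x x0 < d" using \<open>d > 0\<close> by (auto simp: dist_commute)
    from main[OF this] \<open>k0 > 0\<close>
    show "\<forall>v. (sqrt (k0 / 2))\<^sup>2 * (norm v)\<^sup>2 \<le> G x v v"
      "\<forall>w u. norm (\<Gamma> x w u) \<le> (C3 + C4) * norm w * norm u"
      "\<forall>w u. norm (\<Gamma> x w u - \<Gamma> x0 w u) \<le> (C3 + C4) * norm (x - x0) * norm w * norm u"
      by simp_all
  qed
qed

end

section \<open>Charts and tangent vectors\<close>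

context
  fixes X :: "'a topology" and A :: "('a, 'e::euclidean_space) chart set"
  assumes manifold: "smooth_manifold X A"
begin

section \<open>Topology of chart domains\<close>

lemma chart_homeomorphic_map:
  "c \<in> A \<Longrightarrow> homeomorphic_map (subtopology X (cdom c)) (top_of_set (crange c)) (cmap c)"
  and chart_openin_cdom: "c \<in> A \<Longrightarrow> openin X (cdom c)"
  and chart_open_crange: "c \<in> A \<Longrightarrow> open (crange c)"
  and ex_chart_at: "p \<in> topspace X \<Longrightarrow> \<exists>c. c \<in> charts_at A p"
  using manifold unfolding smooth_manifold_def charts_at_def by blast+

lemma chart_topspace: "c \<in> A \<Longrightarrow> topspace (subtopology X (cdom c)) = cdom c"
  using openin_subset[OF chart_openin_cdom] by auto

lemma chart_inj_on: "c \<in> A \<Longrightarrow> inj_on (cmap c) (cdom c)"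
  using chart_homeomorphic_map chart_topspace homeomorphic_eq_everything_map by metis

lemma chart_cinv: "c \<in> charts_at A p \<Longrightarrow> cinv c (cmap c p) = p"
  using chart_inj_on unfolding charts_at_def by (simp add: inv_into_f_f)

lemma chart_at_cinv: "c \<in> A \<Longrightarrow> x \<in> crange c \<Longrightarrow> c \<in> charts_at A (cinv c x)"
  by (simp add: charts_at_def inv_into_into)

lemma chart_open_image:
  assumes "c \<in> A" "openin X W"
  shows "open (cmap c ` (cdom c \<inter> W))"
proof -
  have "openin (subtopology X (cdom c)) (cdom c \<inter> W)"
    using assms(2) openin_subtopology_Int2 by blast
  then have "openin (top_of_set (crange c)) (cmap c ` (cdom c \<inter> W))"
    using homeomorphic_imp_open_map[OF chart_homeomorphic_map[OF assms(1)]] unfolding open_map_def by blast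
  then show ?thesis using chart_open_crange[OF assms(1)] openin_open_trans by blast
qed

lemma chart_openin_vimage:
  assumes "c \<in> A" "open V"
  shows "openin X {q \<in> cdom c. cmap c q \<in> V}"
proof -
  have "continuous_map (subtopology X (cdom c)) (top_of_set (crange c)) (cmap c)"
    using chart_homeomorphic_map[OF assms(1)] homeomorphic_imp_continuous_map by blast
  then have "continuous_map (subtopology X (cdom c)) euclidean (cmap c)"
    using continuous_map_in_subtopology by blast
  then have "openin (subtopology X (cdom c)) {q \<in> topspace (subtopology X (cdom c)). cmap c q \<in> V}"
    by (rule openin_continuous_map_preimage) (simp add: assms(2))
  then show ?thesis
    using chart_topspace[OF assms(1)] chart_openin_cdom[OF assms(1)] openin_trans_full by fastforce
qed

text \<open>Compactness passes through the chart, and compact sets are closed in a Hausdorff space.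
  Closedness holds in all of \<open>X\<close>, not only in the chart domain; this prevents a path
  from slipping out of the chart.\<close>

lemma chart_closedin_vimage:
  assumes "c \<in> A" "compact K" "K \<subseteq> crange c"
  shows "closedin X {q \<in> cdom c. cmap c q \<in> K}"
proof -
  let ?Q = "{q \<in> cdom c. cmap c q \<in> K}"
  have "cmap c ` ?Q = K" using assms(3) by auto
  then have "compactin (top_of_set (crange c)) (cmap c ` ?Q)"
    using assms by (simp add: compactin_subtopology)
  then have "compactin (subtopology X (cdom c)) ?Q"
    using homeomorphic_map_compactness[OF chart_homeomorphic_map[OF assms(1)], of ?Q] chart_topspace[OF assms(1)]
    by auto
  then have "compactin X ?Q" by (simp add: compactin_subtopology)
  then show ?thesis
    using manifold compactin_imp_closedin unfolding smooth_manifold_def by blast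
qed

section \<open>Transition maps and components of tangent vectors\<close>

lemma transition_differentiable:
  assumes "c \<in> charts_at A p" "d \<in> charts_at A p"
  shows "transition c d differentiable (at (cmap c p))"
  using assms manifold unfolding smooth_manifold_def charts_at_def
  by (blast intro: smooth_on_differentiable)

lemma transition_has_derivative:
  assumes "c \<in> charts_at A p" "d \<in> charts_at A p"
  shows "(transition c d has_derivative frechet_derivative (transition c d) (at (cmap c p))) (at (cmap c p))"
  using transition_differentiable[OF assms] frechet_derivative_works by blast

lemma frechet_derivative_transition_linear:
  assumes "c \<in> charts_at A p" "d \<in> charts_at A p"
  shows "linear (frechet_derivative (transition c d) (at (cmap c p)))"
  using transition_has_derivative[OF assms] has_derivative_linear by blast

text \<open>The transition maps compose as expected only on the image of the overlap of
  \<open>c\<close> and \<open>d\<close>; this image is open, so the chain rule applies at the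
  point.\<close>

lemma frechet_derivative_transition_chain:
  assumes "c \<in> charts_at A p" "d \<in> charts_at A p" "e \<in> charts_at A p"
  shows "frechet_derivative (transition c e) (at (cmap c p)) w =
    frechet_derivative (transition d e) (at (cmap d p)) (frechet_derivative (transition c d) (at (cmap c p)) w)"
proof -
  have cd: "c \<in> A" "d \<in> A" "p \<in> cdom c \<inter> cdom d" using assms by (auto simp: charts_at_def)
  have "transition c d (cmap c p) = cmap d p" using chart_cinv[OF assms(1)] by simp
  then have "(transition d e \<circ> transition c d has_derivative
      frechet_derivative (transition d e) (at (cmap d p)) \<circ> frechet_derivative (transition c d) (at (cmap c p)))
      (at (cmap c p))"
    using transition_has_derivative[OF assms(1,2)] transition_has_derivative[OF assms(2,3)]
    by (metis diff_chain_at)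
  moreover have "open (cmap c ` (cdom c \<inter> cdom d))"
    using chart_open_image chart_openin_cdom cd by blast
  moreover have "(transition d e \<circ> transition c d) x = transition c e x" if "x \<in> cmap c ` (cdom c \<inter> cdom d)" for x
    using that chart_inj_on[OF cd(1)] chart_inj_on[OF cd(2)] by (auto simp: inv_into_f_f)
  moreover have "cmap c p \<in> cmap c ` (cdom c \<inter> cdom d)" using cd by blast
  ultimately have "(transition c e has_derivative
      frechet_derivative (transition d e) (at (cmap d p)) \<circ> frechet_derivative (transition c d) (at (cmap c p)))
      (at (cmap c p))"
    by (blast intro: has_derivative_transform_within_open)
  then show ?thesis using frechet_derivative_at by (metis comp_apply)
qed

lemma frechet_derivative_transition_self:
  assumes "c \<in> charts_at A p"
  shows "frechet_derivative (transition c c) (at (cmap c p)) w = w"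
proof -
  have c: "c \<in> A" "p \<in> cdom c" using assms by (auto simp: charts_at_def)
  have "(transition c c has_derivative (\<lambda>w. w)) (at (cmap c p))"
    by (rule has_derivative_transform_within_open[OF has_derivative_ident chart_open_crange[OF c(1)]])
      (use c chart_inj_on[OF c(1)] in \<open>auto simp: inv_into_f_f\<close>)
  then show ?thesis using frechet_derivative_at by metis
qed

lemma tangent_of_in_tangent_space:
  assumes "c \<in> charts_at A p"
  shows "tangent_of A c p w \<in> tangent_space A p"
proof -
  have "tangent_of A c p w e = frechet_derivative (transition d e) (at (cmap d p)) (tangent_of A c p w d)"
    if "d \<in> charts_at A p" "e \<in> charts_at A p" for d e
    unfolding tangent_of_def using that by (simp only: if_True frechet_derivative_transition_chain[OF assms that])
  moreover have "tangent_of A c p w d = 0" if "d \<notin> charts_at A p" for d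
    unfolding tangent_of_def using that by (simp only: if_False)
  ultimately show ?thesis unfolding tangent_space_def by blast
qed

lemma tangent_of_component: "c \<in> charts_at A p \<Longrightarrow> tangent_of A c p w c = w"
  by (simp add: tangent_of_def frechet_derivative_transition_self)

text \<open>A tangent vector is determined by one component. Together with
  \<open>tangent_of_component\<close> this identifies the tangent space with \<open>'e\<close>
  through any single chart.\<close>

lemma tangent_of_tangent:
  assumes "c \<in> charts_at A p" "u \<in> tangent_space A p"
  shows "tangent_of A c p (u c) = u"
proof
  fix d
  show "tangent_of A c p (u c) d = u d"
  proof (cases "d \<in> charts_at A p")
    case True
    then have "u d = frechet_derivative (transition c d) (at (cmap c p)) (u c)"
      using assms unfolding tangent_space_def by blast
    then show ?thesis unfolding tangent_of_def if_P[OF True] by (rule sym)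
  next
    case False
    then have "u d = 0" using assms unfolding tangent_space_def by blast
    then show ?thesis unfolding tangent_of_def if_not_P[OF False] by (rule sym)
  qed
qed

lemma tangent_of_lincomb:
  assumes "c \<in> charts_at A p"
  shows "tangent_of A c p (a *\<^sub>R v + b *\<^sub>R w) =
    (\<lambda>d. a *\<^sub>R tangent_of A c p v d + b *\<^sub>R tangent_of A c p w d)"
  using frechet_derivative_transition_linear[OF assms]
  by (auto simp: tangent_of_def linear_add linear_scale)

lemma tangent_space_diff:
  assumes "c \<in> charts_at A p" "u \<in> tangent_space A p" "v \<in> tangent_space A p"
  shows "u - v \<in> tangent_space A p"
proof -
  have "u - v = tangent_of A c p (1 *\<^sub>R u c + (-1) *\<^sub>R v c)"
    unfolding tangent_of_lincomb[OF assms(1)] tangent_of_tangent[OF assms(1,2)] tangent_of_tangent[OF assms(1,3)]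
    by auto
  then show ?thesis using tangent_of_in_tangent_space[OF assms(1)] by simp
qed

end

section \<open>The metric and its connection read in a chart\<close>

lemma riemannian_manifold_smooth_manifold: "riemannian_manifold X A g \<Longrightarrow> smooth_manifold X A"
  by (simp add: riemannian_manifold_def)

lemma metric_in_chart_at:
  assumes "smooth_manifold X A" "c \<in> charts_at A p" "u \<in> tangent_space A p" "v \<in> tangent_space A p"
  shows "g p u v = metric_in_chart A g c (cmap c p) (u c) (v c)"
  unfolding metric_in_chart_def
  by (simp only: chart_cinv[OF assms(1,2)] tangent_of_tangent[OF assms(1,2,3)] tangent_of_tangent[OF assms(1,2,4)])

text \<open>The form in the chart is the pullback of the inner product along
  \<open>tangent_of\<close>, which is linear and injective because the component in \<open>c\<close>
  gives the argument back.\<close>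

lemma riemannian_metric_on_chart:
  fixes A :: "('a, 'e::euclidean_space) chart set"
  assumes "riemannian_manifold X A g" "c \<in> A"
  shows "riemannian_metric_on (crange c) (metric_in_chart A g c)"
proof -
  note M = riemannian_manifold_smooth_manifold[OF assms(1)]
  have "pos_def_form (metric_in_chart A g c x)" if x: "x \<in> crange c" for x
  proof -
    define q where "q = cinv c x"
    have c: "c \<in> charts_at A q" unfolding q_def using chart_at_cinv[OF M assms(2) x] .
    have "q \<in> topspace X"
      using c openin_subset[OF chart_openin_cdom[OF M assms(2)]] unfolding charts_at_def by blast
    then have ip: "inner_product_on (tangent_space A q) (g q)"
      using assms(1) by (simp only: riemannian_manifold_def)
    have G: "metric_in_chart A g c x v w = g q (tangent_of A c q v) (tangent_of A c q w)" for v w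
      by (simp only: metric_in_chart_def q_def)
    note T = tangent_of_in_tangent_space[OF M c]
    have ip_lin: "g q (\<lambda>d. a *\<^sub>R u d + b *\<^sub>R v d) w = a * g q u w + b * g q v w"
      and ip_sym: "g q u v = g q v u" and ip_pos: "u \<noteq> (\<lambda>d. 0) \<Longrightarrow> g q u u > 0"
      if "u \<in> tangent_space A q" "v \<in> tangent_space A q" "w \<in> tangent_space A q" for a b u v w
      using ip that unfolding inner_product_on_def by blast+
    have lin: "metric_in_chart A g c x (a *\<^sub>R u + b *\<^sub>R v) w =
        a * metric_in_chart A g c x u w + b * metric_in_chart A g c x v w" for a b u v w
      unfolding G tangent_of_lincomb[OF M c] by (rule ip_lin[OF T T T])
    have sym: "metric_in_chart A g c x v w = metric_in_chart A g c x w v" for v w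
      unfolding G by (rule ip_sym[OF T T T])
    have lin1: "linear (\<lambda>v. metric_in_chart A g c x v w)" for w
      by (rule linearI) (use lin[of 1 _ 1] lin[of _ _ 0] in simp_all)
    have lin2: "linear (metric_in_chart A g c x v)" for v
      using lin1[of v] by (subst ext[OF sym[of v]])
    have "metric_in_chart A g c x v v > 0" if "v \<noteq> 0" for v
    proof -
      have "tangent_of A c q v \<noteq> (\<lambda>d. 0)"
        using tangent_of_component[OF M c, of v] that by metis
      then show ?thesis unfolding G by (rule ip_pos[OF T T T])
    qed
    moreover have "bilinear (metric_in_chart A g c x)"
      unfolding bilinear_def using lin1 lin2 by (intro conjI allI)
    ultimately show ?thesis unfolding pos_def_form_def using sym by blast
  qed
  moreover have "\<forall>v w. smooth_on (crange c) (\<lambda>x. metric_in_chart A g c x v w)"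
    using assms by (simp add: riemannian_manifold_def)
  ultimately show ?thesis
    using chart_open_crange[OF M assms(2)] by (simp add: riemannian_metric_on_def)
qed

text \<open>Existence and uniqueness turn the description in \<open>levi_civita\<close> into its
  defining property.\<close>

lemma levi_civita_torsion_free_metric:
  assumes "riemannian_manifold X A g" "c \<in> A" "x \<in> crange c"
  shows "torsion_free_metric (metric_in_chart A g c x) (metric_deriv (metric_in_chart A g c) x) (levi_civita A g c x)"
proof -
  have "levi_civita A g c x = (THE \<Gamma>. torsion_free_metric (metric_in_chart A g c x)
      (metric_deriv (metric_in_chart A g c) x) \<Gamma>)"
    by (simp add: levi_civita_def torsion_free_metric_def metric_deriv_def)
  then show ?thesis
    using theI'[OF torsion_free_metric_ex1_on[OF riemannian_metric_on_chart[OF assms(1,2)] assms(3)]] by simp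
qed

section \<open>Length of piecewise smooth curves\<close>

lemma pathin_openin_vimage:
  assumes "pathin X \<alpha>" "openin X W" "t \<in> {0..1}" "\<alpha> t \<in> W"
  shows "\<exists>\<delta>>0. \<forall>s\<in>{0..1}. dist s t < \<delta> \<longrightarrow> \<alpha> s \<in> W"
proof -
  have "openin (top_of_set {0..1}) {s \<in> {0..1}. \<alpha> s \<in> W}"
    using openin_continuous_map_preimage[of "top_of_set {0..1}" X \<alpha> W] assms(1,2) by (simp add: pathin_def)
  then show ?thesis
    unfolding openin_euclidean_subtopology_iff using assms(3,4) by fastforce
qed

lemma pathin_open_vimage:
  assumes "pathin X \<alpha>" "openin X W"
  shows "open {s \<in> {0<..<1}. \<alpha> s \<in> W}"
proof -
  have "openin (top_of_set {0..1}) {s \<in> {0..1}. \<alpha> s \<in> W}"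
    using openin_continuous_map_preimage[of "top_of_set {0..1}" X \<alpha> W] assms by (simp add: pathin_def)
  then obtain T where "open T" "{s \<in> {0..1}. \<alpha> s \<in> W} = {0..1} \<inter> T"
    unfolding openin_open by blast
  then have "{s \<in> {0<..<1}. \<alpha> s \<in> W} = {0<..<1} \<inter> T" by fastforce
  then show ?thesis using \<open>open T\<close> by (simp add: open_Int)
qed

lemma pathin_closed_vimage:
  assumes "pathin X \<alpha>" "closedin X W"
  shows "closed {s \<in> {0..1}. \<alpha> s \<in> W}"
proof -
  have "closedin (top_of_set {0..1}) {s \<in> {0..1}. \<alpha> s \<in> W}"
    using closedin_continuous_map_preimage[of "top_of_set {0..1}" X \<alpha> W] assms by (simp add: pathin_def)
  then show ?thesis using closedin_closed_trans by blast
qed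

text \<open>At a partition point \<open>t\<close> the piece to the right is chosen, so the piece
  always contains a right neighbourhood of \<open>t\<close>; \<open>partition_left\<close> is the
  mirror image.\<close>

lemma partition_right:
  fixes P :: "real set"
  assumes "finite P" "{0, 1} \<subseteq> P" "t \<in> {0..<1}"
  obtains a b where "a \<in> P" "b \<in> P" "a \<le> t" "t < b" "P \<inter> {a<..<b} = {}"
proof
  let ?L = "{x \<in> P. x \<le> t}" and ?R = "{x \<in> P. t < x}"
  have fin: "finite ?L" "finite ?R" and ne: "?L \<noteq> {}" "?R \<noteq> {}"
    using assms by auto
  show "Max ?L \<in> P" "Max ?L \<le> t" using Max_in[OF fin(1) ne(1)] by auto
  show "Min ?R \<in> P" "t < Min ?R" using Min_in[OF fin(2) ne(2)] by auto
  show "P \<inter> {Max ?L<..<Min ?R} = {}"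
    using Max_ge[OF fin(1)] Min_le[OF fin(2)] by (force simp: not_le[symmetric])
qed

lemma partition_left:
  fixes P :: "real set"
  assumes "finite P" "{0, 1} \<subseteq> P" "t \<in> {0<..1}"
  obtains a b where "a \<in> P" "b \<in> P" "a < t" "t \<le> b" "P \<inter> {a<..<b} = {}"
proof
  let ?L = "{x \<in> P. x < t}" and ?R = "{x \<in> P. t \<le> x}"
  have fin: "finite ?L" "finite ?R" and ne: "?L \<noteq> {}" "?R \<noteq> {}"
    using assms by auto
  show "Max ?L \<in> P" "Max ?L < t" using Max_in[OF fin(1) ne(1)] by auto
  show "Min ?R \<in> P" "t \<le> Min ?R" using Min_in[OF fin(2) ne(2)] by auto
  show "P \<inter> {Max ?L<..<Min ?R} = {}"
    using Max_ge[OF fin(1)] Min_le[OF fin(2)] by (force simp: not_le[symmetric])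
qed

text \<open>Smoothness of the metric is given for fixed vectors only; expanding both arguments in
  the basis leaves a finite sum of products of continuous functions.\<close>

lemma continuous_on_riemannian_metric:
  fixes G :: "'e::euclidean_space \<Rightarrow> 'e \<Rightarrow> 'e \<Rightarrow> real"
  assumes G: "riemannian_metric_on U G"
    and "continuous_on T x" "continuous_on T u" "continuous_on T v" "x ` T \<subseteq> U"
  shows "continuous_on T (\<lambda>s. G (x s) (u s) (v s))"
proof -
  have "G (x s) (u s) (v s) = (\<Sum>b\<in>Basis. \<Sum>b'\<in>Basis. (u s \<bullet> b) * ((v s \<bullet> b') * G (x s) b b'))" if "s \<in> T" for s
  proof -
    have bil: "bilinear (G (x s))" using metric_bilinear[OF G] assms(5) that by blast
    have "G (x s) (u s) (v s) =
        G (x s) (\<Sum>b\<in>Basis. (u s \<bullet> b) *\<^sub>R b) (\<Sum>b\<in>Basis. (v s \<bullet> b) *\<^sub>R b)"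
      by (simp add: euclidean_representation)
    also have "\<dots> = (\<Sum>(b, b')\<in>Basis \<times> Basis. G (x s) ((u s \<bullet> b) *\<^sub>R b) ((v s \<bullet> b') *\<^sub>R b'))"
      by (rule bilinear_sum[OF bil])
    finally show ?thesis
      by (simp add: sum.cartesian_product[symmetric] bilinear_lmul[OF bil] bilinear_rmul[OF bil] mult.left_commute)
  qed
  moreover have "continuous_on T (\<lambda>s. G (x s) b b')" for b b'
  proof -
    have "continuous_on U (\<lambda>x. G x b b')"
      using G smooth_on_continuous_on unfolding riemannian_metric_on_def by blast
    then show ?thesis
      by (rule continuous_on_compose2[OF _ assms(2,5)])
  qed
  ultimately show ?thesis
    using assms(3,4) by (simp cong: continuous_on_cong_simp) (intro continuous_intros)
qed

section \<open>Integrability of the speed\<close>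

context
  fixes X :: "'a topology" and A :: "('a, 'e::euclidean_space) chart set" and g
  assumes riem: "riemannian_manifold X A g"
begin

private lemmas M = riemannian_manifold_smooth_manifold[OF riem]

text \<open>A derivative in one chart yields the derivatives in all others by the chain rule, so
  \<open>velocity\<close> is a genuine tangent vector wherever one coordinate curve is
  differentiable.\<close>

lemma velocity_eq_tangent_of:
  assumes "pathin X \<alpha>" "t \<in> {0<..<1}" "c \<in> charts_at A (\<alpha> t)"
    and v: "((cmap c \<circ> \<alpha>) has_vector_derivative v) (at t)"
  shows "velocity A \<alpha> t = tangent_of A c (\<alpha> t) v"
proof
  fix d
  show "velocity A \<alpha> t d = tangent_of A c (\<alpha> t) v d"
  proof (cases "d \<in> charts_at A (\<alpha> t)")
    case True
    let ?D = "frechet_derivative (transition c d) (at (cmap c (\<alpha> t)))"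
    have cd: "c \<in> A" "d \<in> A" "\<alpha> t \<in> cdom c \<inter> cdom d"
      using True assms(3) by (auto simp: charts_at_def)
    have "(transition c d \<circ> (cmap c \<circ> \<alpha>) has_derivative ?D \<circ> (\<lambda>h. h *\<^sub>R v)) (at t)"
      using v transition_has_derivative[OF M assms(3) True]
      unfolding has_vector_derivative_def by (intro diff_chain_at) simp_all
    moreover have "?D \<circ> (\<lambda>h. h *\<^sub>R v) = (\<lambda>h. h *\<^sub>R ?D v)"
      using linear_scale[OF frechet_derivative_transition_linear[OF M assms(3) True]] by auto
    ultimately have "(transition c d \<circ> (cmap c \<circ> \<alpha>) has_derivative (\<lambda>h. h *\<^sub>R ?D v)) (at t)"
      by simp
    moreover have "open {s \<in> {0<..<1}. \<alpha> s \<in> cdom c \<inter> cdom d}"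
      by (intro pathin_open_vimage[OF assms(1)] openin_Int chart_openin_cdom[OF M] cd)
    ultimately have "((cmap d \<circ> \<alpha>) has_derivative (\<lambda>h. h *\<^sub>R ?D v)) (at t)"
      by (rule has_derivative_transform_within_open)
        (use cd assms(2) chart_inj_on[OF M cd(1)] in \<open>auto simp: inv_into_f_f\<close>)
    then have "vector_derivative (cmap d \<circ> \<alpha>) (at t) = ?D v"
      by (intro vector_derivative_at) (simp add: has_vector_derivative_def)
    then show ?thesis using True by (simp add: velocity_def tangent_of_def)
  next
    case False
    then show ?thesis by (simp add: velocity_def tangent_of_def)
  qed
qed

lemma speed_in_chart:
  assumes "pathin X \<alpha>" "t \<in> {0<..<1}" "c \<in> charts_at A (\<alpha> t)"
    and v: "((cmap c \<circ> \<alpha>) has_vector_derivative v) (at t)"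
  shows "tnorm g (\<alpha> t) (velocity A \<alpha> t) = sqrt (metric_in_chart A g c (cmap c (\<alpha> t)) v v)"
  using velocity_eq_tangent_of[OF assms] chart_cinv[OF M assms(3)]
  by (simp add: tnorm_def metric_in_chart_def)

text \<open>Inside the arc the speed is a continuous expression in the smooth extension
  \<open>f\<close>. At the two ends \<open>velocity\<close> is a two-sided derivative that may have
  nothing to do with \<open>f\<close>, but two points do not affect integrability.\<close>

lemma speed_integrable_smooth_arc:
  assumes "pathin X \<alpha>" "c \<in> A" "0 \<le> a" "b \<le> 1"
    and f: "smooth_on V f" "open V" "{a..b} \<subseteq> V"
    and c: "\<And>s. s \<in> {a..b} \<Longrightarrow> \<alpha> s \<in> cdom c"
    and eq: "\<And>s. s \<in> {a..b} \<Longrightarrow> cmap c (\<alpha> s) = f s"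
  shows "(\<lambda>t. tnorm g (\<alpha> t) (velocity A \<alpha> t)) integrable_on {a..b}"
proof -
  let ?G = "metric_in_chart A g c" and ?f' = "\<lambda>s. frechet_derivative f (at s) 1"
  have "continuous_on {a..b} f" "continuous_on {a..b} ?f'"
    using smooth_on_continuous_on[OF f(1)] smooth_on_continuous_on[OF smooth_on_frechet_derivative[OF f(1), of 1]]
      continuous_on_subset f(3) by blast+
  moreover have "f ` {a..b} \<subseteq> crange c" using c eq by force
  ultimately have "continuous_on {a..b} (\<lambda>s. ?G (f s) (?f' s) (?f' s))"
    using continuous_on_riemannian_metric[OF riemannian_metric_on_chart[OF riem assms(2)]] by blast
  then have int: "(\<lambda>s. sqrt (?G (f s) (?f' s) (?f' s))) integrable_on {a..b}"
    by (intro integrable_continuous_real continuous_on_real_sqrt)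
  have "tnorm g (\<alpha> s) (velocity A \<alpha> s) = sqrt (?G (f s) (?f' s) (?f' s))" if s: "s \<in> {a..b} - {a, b}" for s
  proof -
    have der: "(f has_derivative frechet_derivative f (at s)) (at s)"
      using smooth_on_differentiable[OF f(1)] f(3) s frechet_derivative_works by blast
    have "(f has_derivative (\<lambda>h. h *\<^sub>R ?f' s)) (at s)"
    proof (rule has_derivative_eq_rhs[OF der], rule ext)
      show "frechet_derivative f (at s) h = h *\<^sub>R ?f' s" for h
        using linear_scale[OF has_derivative_linear[OF der], of h 1] by (simp only: real_scaleR_def mult_1_right)
    qed
    then have "((cmap c \<circ> \<alpha>) has_derivative (\<lambda>h. h *\<^sub>R ?f' s)) (at s)"
      by (rule has_derivative_transform_within_open[of _ _ _ _ "{a<..<b}"]) (use s eq in auto)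
    then have "((cmap c \<circ> \<alpha>) has_vector_derivative ?f' s) (at s)"
      by (simp add: has_vector_derivative_def)
    moreover have "c \<in> charts_at A (\<alpha> s)" using assms(2) c s by (simp add: charts_at_def)
    ultimately show ?thesis
      using speed_in_chart[OF assms(1), of s c] s eq assms(3,4) by auto
  qed
  then show ?thesis
    using integrable_spike_finite[of "{a, b}" "{a..b}", OF _ _ int] by auto
qed

context
  fixes \<alpha>
  assumes path: "piecewise_smooth_path X A \<alpha>"
begin

lemma path_pathin: "pathin X \<alpha>"
  using path by (simp add: piecewise_smooth_path_def)

lemma path_in_chart: "t \<in> {0..1} \<Longrightarrow> \<exists>c. c \<in> charts_at A (\<alpha> t)"
  by (rule ex_chart_at[OF M])
    (use path_pathin in \<open>auto simp: pathin_def continuous_map_def\<close>)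

text \<open>Integrability is shown on each side of \<open>t\<close> separately, because at a corner
  the two sides have different smooth extensions.\<close>

lemma speed_integrable_right:
  assumes "t \<in> {0..<1}"
  shows "\<exists>\<epsilon>>0. \<forall>b. t \<le> b \<and> b < t + \<epsilon> \<and> b \<le> 1 \<longrightarrow>
    (\<lambda>t. tnorm g (\<alpha> t) (velocity A \<alpha> t)) integrable_on {t..b}"
proof -
  obtain P where "finite P" "{0, 1} \<subseteq> P" and
    P: "\<forall>a\<in>P. \<forall>b\<in>P. a < b \<and> P \<inter> {a<..<b} = {} \<longrightarrow> smooth_curve_on A a b \<alpha>"
    using path unfolding piecewise_smooth_path_def by blast
  obtain a b where ab: "a \<in> P" "b \<in> P" "a \<le> t" "t < b" "P \<inter> {a<..<b} = {}"
    using partition_right[OF \<open>finite P\<close> \<open>{0, 1} \<subseteq> P\<close> assms] by blast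
  obtain c where c: "c \<in> charts_at A (\<alpha> t)" using path_in_chart assms by force
  have "smooth_curve_on A a b \<alpha>" using P ab by force
  then obtain \<epsilon> f where "\<epsilon> > 0" and f: "smooth_on {t - \<epsilon><..<t + \<epsilon>} f"
    "\<forall>s\<in>{a..b} \<inter> {t - \<epsilon><..<t + \<epsilon>}. cmap c (\<alpha> s) = f s"
    using c ab unfolding smooth_curve_on_def by (meson atLeastAtMost_iff less_imp_le)
  have cA: "c \<in> A" "\<alpha> t \<in> cdom c" using c by (auto simp: charts_at_def)
  obtain \<delta> where "\<delta> > 0" and \<delta>: "\<forall>s\<in>{0..1}. dist s t < \<delta> \<longrightarrow> \<alpha> s \<in> cdom c"
    using pathin_openin_vimage[OF path_pathin chart_openin_cdom[OF M cA(1)] _ cA(2)] assms by force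
  \<comment> \<open>The three radii keep the arc within the domain of \<open>f\<close>, the chart
    domain and the smooth piece.\<close>
  have "(\<lambda>t. tnorm g (\<alpha> t) (velocity A \<alpha> t)) integrable_on {t..b'}"
    if b': "t \<le> b'" "b' < t + Min {\<epsilon>, \<delta>, b - t}" "b' \<le> 1" for b'
  proof (rule speed_integrable_smooth_arc[OF path_pathin cA(1) _ _ f(1)])
    show "0 \<le> t" "b' \<le> 1" "open {t - \<epsilon><..<t + \<epsilon>}" "{t..b'} \<subseteq> {t - \<epsilon><..<t + \<epsilon>}"
      using assms b' \<open>\<epsilon> > 0\<close> by auto
    fix s assume "s \<in> {t..b'}"
    then have "s \<in> {0..1}" "dist s t < \<delta>" "s \<in> {a..b} \<inter> {t - \<epsilon><..<t + \<epsilon>}"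
      using assms b' ab(3) \<open>\<epsilon> > 0\<close> by (auto simp: dist_real_def)
    then show "\<alpha> s \<in> cdom c" "cmap c (\<alpha> s) = f s" using \<delta> f(2) by blast+
  qed
  moreover have "Min {\<epsilon>, \<delta>, b - t} > 0" using \<open>\<epsilon> > 0\<close> \<open>\<delta> > 0\<close> ab by simp
  ultimately show ?thesis by blast
qed

lemma speed_integrable_left:
  assumes "t \<in> {0<..1}"
  shows "\<exists>\<epsilon>>0. \<forall>a. a \<le> t \<and> t - \<epsilon> < a \<and> 0 \<le> a \<longrightarrow>
    (\<lambda>t. tnorm g (\<alpha> t) (velocity A \<alpha> t)) integrable_on {a..t}"
proof -
  obtain P where "finite P" "{0, 1} \<subseteq> P" and
    P: "\<forall>a\<in>P. \<forall>b\<in>P. a < b \<and> P \<inter> {a<..<b} = {} \<longrightarrow> smooth_curve_on A a b \<alpha>"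
    using path unfolding piecewise_smooth_path_def by blast
  obtain a b where ab: "a \<in> P" "b \<in> P" "a < t" "t \<le> b" "P \<inter> {a<..<b} = {}"
    using partition_left[OF \<open>finite P\<close> \<open>{0, 1} \<subseteq> P\<close> assms] by blast
  obtain c where c: "c \<in> charts_at A (\<alpha> t)" using path_in_chart assms by force
  have "smooth_curve_on A a b \<alpha>" using P ab by force
  then obtain \<epsilon> f where "\<epsilon> > 0" and f: "smooth_on {t - \<epsilon><..<t + \<epsilon>} f"
    "\<forall>s\<in>{a..b} \<inter> {t - \<epsilon><..<t + \<epsilon>}. cmap c (\<alpha> s) = f s"
    using c ab unfolding smooth_curve_on_def by (meson atLeastAtMost_iff less_imp_le)
  have cA: "c \<in> A" "\<alpha> t \<in> cdom c" using c by (auto simp: charts_at_def)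
  obtain \<delta> where "\<delta> > 0" and \<delta>: "\<forall>s\<in>{0..1}. dist s t < \<delta> \<longrightarrow> \<alpha> s \<in> cdom c"
    using pathin_openin_vimage[OF path_pathin chart_openin_cdom[OF M cA(1)] _ cA(2)] assms by force
  have "(\<lambda>t. tnorm g (\<alpha> t) (velocity A \<alpha> t)) integrable_on {a'..t}"
    if a': "a' \<le> t" "t - Min {\<epsilon>, \<delta>, t - a} < a'" "0 \<le> a'" for a'
  proof (rule speed_integrable_smooth_arc[OF path_pathin cA(1) _ _ f(1)])
    show "0 \<le> a'" "t \<le> 1" "open {t - \<epsilon><..<t + \<epsilon>}" "{a'..t} \<subseteq> {t - \<epsilon><..<t + \<epsilon>}"
      using assms a' \<open>\<epsilon> > 0\<close> by auto
    fix s assume "s \<in> {a'..t}"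
    then have "s \<in> {0..1}" "dist s t < \<delta>" "s \<in> {a..b} \<inter> {t - \<epsilon><..<t + \<epsilon>}"
      using assms a' ab(4) \<open>\<epsilon> > 0\<close> by (auto simp: dist_real_def)
    then show "\<alpha> s \<in> cdom c" "cmap c (\<alpha> s) = f s" using \<delta> f(2) by blast+
  qed
  moreover have "Min {\<epsilon>, \<delta>, t - a} > 0" using \<open>\<epsilon> > 0\<close> \<open>\<delta> > 0\<close> ab by simp
  ultimately show ?thesis by blast
qed

text \<open>Bisection globalizes the one-sided local statements. Without integrability the integral
  in \<open>curve_length\<close> would have the default value 0 and carry no information about the
  curve.\<close>

lemma speed_integrable: "(\<lambda>t. tnorm g (\<alpha> t) (velocity A \<alpha> t)) integrable_on {0..1}"
proof -
  let ?\<sigma> = "\<lambda>t. tnorm g (\<alpha> t) (velocity A \<alpha> t)"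
  have "0 \<le> (0::real) \<longrightarrow> 1 \<le> (1::real) \<longrightarrow> ?\<sigma> integrable_on {0..1}"
  proof (rule Bolzano[of 0 1 "\<lambda>a b. 0 \<le> a \<longrightarrow> b \<le> 1 \<longrightarrow> ?\<sigma> integrable_on {a..b}"])
    fix a b c :: real
    assume "0 \<le> a \<longrightarrow> b \<le> 1 \<longrightarrow> ?\<sigma> integrable_on {a..b}" "0 \<le> b \<longrightarrow> c \<le> 1 \<longrightarrow> ?\<sigma> integrable_on {b..c}"
      "a \<le> b" "b \<le> c"
    then show "0 \<le> a \<longrightarrow> c \<le> 1 \<longrightarrow> ?\<sigma> integrable_on {a..c}"
      using Henstock_Kurzweil_Integration.integrable_combine[of a b c ?\<sigma>] by auto
  next
    fix x :: real assume x: "0 \<le> x" "x \<le> 1"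
    obtain e1 where "e1 > 0" and e1: "\<And>b. x \<le> b \<Longrightarrow> b < x + e1 \<Longrightarrow> b \<le> 1 \<Longrightarrow> ?\<sigma> integrable_on {x..b}"
    proof (cases "x < 1")
      case True
      then show ?thesis using speed_integrable_right[of x] x that by auto
    next
      case False
      then have "b = x" if "x \<le> b" "b \<le> 1" for b using that by linarith
      then show ?thesis using that[of 1] integrable_on_refl[of ?\<sigma> x] by (metis interval_cbox zero_less_one)
    qed
    obtain e2 where "e2 > 0" and e2: "\<And>a. a \<le> x \<Longrightarrow> x - e2 < a \<Longrightarrow> 0 \<le> a \<Longrightarrow> ?\<sigma> integrable_on {a..x}"
    proof (cases "0 < x")
      case True
      then show ?thesis using speed_integrable_left[of x] x that by auto
    next
      case False
      then have "b = x" if "b \<le> x" "0 \<le> b" for b using that by linarith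
      then show ?thesis using that[of 1] integrable_on_refl[of ?\<sigma> x] by (metis interval_cbox zero_less_one)
    qed
    show "\<exists>d>0. \<forall>a b. a \<le> x \<and> x \<le> b \<and> b - a < d \<longrightarrow> 0 \<le> a \<longrightarrow> b \<le> 1 \<longrightarrow> ?\<sigma> integrable_on {a..b}"
    proof (intro exI[of _ "min e1 e2"] conjI allI impI)
      show "min e1 e2 > 0" using \<open>e1 > 0\<close> \<open>e2 > 0\<close> by simp
      fix a b assume "a \<le> x \<and> x \<le> b \<and> b - a < min e1 e2" "0 \<le> a" "b \<le> 1"
      then show "?\<sigma> integrable_on {a..b}"
        using e1[of b] e2[of a] Henstock_Kurzweil_Integration.integrable_combine[of a x b ?\<sigma>] by auto
    qed
  qed simp
  then show ?thesis by simp
qed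

text \<open>Away from the partition points \<open>t\<close> is interior to a smooth piece, where the
  coordinate curve agrees with its smooth extension on both sides.\<close>

lemma path_has_velocity:
  "\<exists>S. finite S \<and> (\<forall>t\<in>{0<..<1} - S. \<forall>c\<in>charts_at A (\<alpha> t).
     ((cmap c \<circ> \<alpha>) has_vector_derivative velocity A \<alpha> t c) (at t))"
proof -
  obtain P where "finite P" "{0, 1} \<subseteq> P" and
    P: "\<forall>a\<in>P. \<forall>b\<in>P. a < b \<and> P \<inter> {a<..<b} = {} \<longrightarrow> smooth_curve_on A a b \<alpha>"
    using path unfolding piecewise_smooth_path_def by blast
  have "((cmap c \<circ> \<alpha>) has_vector_derivative velocity A \<alpha> t c) (at t)"
    if t: "t \<in> {0<..<1} - P" and c: "c \<in> charts_at A (\<alpha> t)" for t c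
  proof -
    obtain a b where ab: "a \<in> P" "b \<in> P" "a \<le> t" "t < b" "P \<inter> {a<..<b} = {}"
      using partition_right[OF \<open>finite P\<close> \<open>{0, 1} \<subseteq> P\<close>, of t] t by auto
    then have "a < t" using t by force
    have "smooth_curve_on A a b \<alpha>" using P ab by force
    then obtain \<epsilon> f where "\<epsilon> > 0" and f: "smooth_on {t - \<epsilon><..<t + \<epsilon>} f"
      "\<forall>s\<in>{a..b} \<inter> {t - \<epsilon><..<t + \<epsilon>}. cmap c (\<alpha> s) = f s"
      using c ab unfolding smooth_curve_on_def by (meson atLeastAtMost_iff less_imp_le)
    have "f differentiable (at t)" using smooth_on_differentiable[OF f(1)] \<open>\<epsilon> > 0\<close> by simp
    then obtain v where "(f has_vector_derivative v) (at t)"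
      using vector_derivative_works by blast
    then have "((cmap c \<circ> \<alpha>) has_vector_derivative v) (at t)"
      by (rule has_vector_derivative_transform_within_open[of _ _ _ "{a<..<b} \<inter> {t - \<epsilon><..<t + \<epsilon>}"])
        (use f(2) \<open>a < t\<close> ab \<open>\<epsilon> > 0\<close> in auto)
    then show ?thesis using c vector_derivative_at by (fastforce simp: velocity_def)
  qed
  then show ?thesis using \<open>finite P\<close> by blast
qed

text \<open>At the corners of \<open>\<alpha>\<close> the velocity need not be a tangent vector, so \<open>tnorm\<close> may even be
  negative there; hence the speed is replaced by a function that agrees with it elsewhere.\<close>

lemma path_speed:
  "\<exists>S \<sigma>. finite S \<and> (\<sigma> has_integral curve_length A g \<alpha>) {0..1} \<and> (\<forall>t. 0 \<le> \<sigma> t) \<and>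
     (\<forall>t\<in>{0<..<1} - S. \<forall>c\<in>charts_at A (\<alpha> t).
        ((cmap c \<circ> \<alpha>) has_vector_derivative velocity A \<alpha> t c) (at t) \<and>
        (\<sigma> t)\<^sup>2 = metric_in_chart A g c (cmap c (\<alpha> t)) (velocity A \<alpha> t c) (velocity A \<alpha> t c))"
proof -
  obtain S where "finite S" and S: "\<And>t c. t \<in> {0<..<1} - S \<Longrightarrow> c \<in> charts_at A (\<alpha> t) \<Longrightarrow>
      ((cmap c \<circ> \<alpha>) has_vector_derivative velocity A \<alpha> t c) (at t)"
    using path_has_velocity by blast
  define \<sigma> where "\<sigma> t = (if t \<in> {0<..<1} - S then tnorm g (\<alpha> t) (velocity A \<alpha> t) else 0)" for t
  have sq: "0 \<le> \<sigma> t \<and> (\<sigma> t)\<^sup>2 = metric_in_chart A g c (cmap c (\<alpha> t)) (velocity A \<alpha> t c) (velocity A \<alpha> t c)"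
    if "t \<in> {0<..<1} - S" "c \<in> charts_at A (\<alpha> t)" for t c
  proof -
    let ?G = "metric_in_chart A g c (cmap c (\<alpha> t))" and ?v = "velocity A \<alpha> t c"
    have "pos_def_form ?G"
      using riemannian_metric_on_chart[OF riem, of c] that(2)
      by (auto simp: riemannian_metric_on_def charts_at_def)
    then obtain k where "k > 0" "k * (norm ?v)\<^sup>2 \<le> ?G ?v ?v" using pos_def_form_coercive by blast
    then have "?G ?v ?v \<ge> 0" by (smt (verit) mult_nonneg_nonneg zero_le_power2)
    then show ?thesis
      using speed_in_chart[OF path_pathin _ that(2) S[OF that]] that(1) by (simp add: \<sigma>_def)
  qed
  have "((\<lambda>t. tnorm g (\<alpha> t) (velocity A \<alpha> t)) has_integral curve_length A g \<alpha>) {0..1}"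
    using speed_integrable unfolding curve_length_def by (simp add: integrable_integral)
  then have "(\<sigma> has_integral curve_length A g \<alpha>) {0..1}"
    by (rule has_integral_spike_finite[of "S \<union> {0, 1}", rotated 2]) (use \<open>finite S\<close> in \<open>auto simp: \<sigma>_def\<close>)
  moreover have "0 \<le> \<sigma> t" for t
  proof (cases "t \<in> {0<..<1} - S")
    case True
    then obtain c where "c \<in> charts_at A (\<alpha> t)" using path_in_chart[of t] by auto
    then show ?thesis using sq True by blast
  qed (simp only: \<sigma>_def if_False)
  ultimately show ?thesis using \<open>finite S\<close> S sq by blast
qed

lemma curve_length_nonneg: "0 \<le> curve_length A g \<alpha>"
  using path_speed has_integral_nonneg by metis

end
end

section \<open>Parallel translation along short loops\<close>

lemma chart_curve_continuous_on:
  assumes M: "smooth_manifold X A" and "pathin X \<alpha>" "c \<in> A" "T \<subseteq> {0..1}" "\<alpha> ` T \<subseteq> cdom c"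
  shows "continuous_on T (cmap c \<circ> \<alpha>)"
proof -
  have "continuous_map (top_of_set T) X \<alpha>"
    using assms(2,4) unfolding pathin_def by (metis continuous_map_from_subtopology inf.absorb_iff2 subtopology_subtopology)
  then have 1: "continuous_map (top_of_set T) (subtopology X (cdom c)) \<alpha>"
    using assms(5) by (simp add: continuous_map_in_subtopology image_subset_iff_funcset)
  have "continuous_map (subtopology X (cdom c)) (top_of_set (crange c)) (cmap c)"
    by (rule homeomorphic_imp_continuous_map[OF chart_homeomorphic_map[OF M assms(3)]])
  then have "continuous_map (subtopology X (cdom c)) euclidean (cmap c)"
    using continuous_map_in_subtopology by blast
  then show ?thesis
    using continuous_map_compose[OF 1] by (metis continuous_map_iff_continuous)
qed

text \<open>At a maximum \<open>m\<close> of the norm of \<open>y\<close> the drift is at most half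
  of \<open>norm (y m)\<close>, which gives the factor 2 without a Gronwall argument. In the second
  estimate, the error terms in the derivative of the corrected curve each carry one factor
  \<open>l\<close>, from the distance to \<open>x0\<close> or from the drift of \<open>y\<close>;
  integrating the speed supplies the other.\<close>

lemma parallel_loop_estimate:
  fixes \<gamma> y :: "real \<Rightarrow> 'e::euclidean_space" and \<Gamma> :: "'e \<Rightarrow> 'e \<Rightarrow> 'e \<Rightarrow> 'e"
  assumes "finite S" "continuous_on {0..1} \<gamma>" "continuous_on {0..1} y" "\<gamma> 0 = x0" "\<gamma> 1 = x0"
    and \<gamma>': "\<And>t. t \<in> {0<..<1} - S \<Longrightarrow> (\<gamma> has_vector_derivative \<gamma>' t) (at t)"
    and y': "\<And>t. t \<in> {0<..<1} - S \<Longrightarrow> (y has_vector_derivative - \<Gamma> (\<gamma> t) (\<gamma>' t) (y t)) (at t)"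
    and \<sigma>: "(\<sigma> has_integral l) {0..1}" "\<And>t. 0 \<le> \<sigma> t"
    and "k > 0" and speed: "\<And>t. t \<in> {0<..<1} - S \<Longrightarrow> k * norm (\<gamma>' t) \<le> \<sigma> t"
    and near: "\<And>t. t \<in> {0..1} \<Longrightarrow> k * norm (\<gamma> t - x0) \<le> l"
    and "bilinear (\<Gamma> x0)" "C \<ge> 0"
    and \<Gamma>: "\<And>t w u. t \<in> {0..1} \<Longrightarrow> norm (\<Gamma> (\<gamma> t) w u) \<le> C * norm w * norm u"
    and lip: "\<And>t w u. t \<in> {0..1} \<Longrightarrow>
      norm (\<Gamma> (\<gamma> t) w u - \<Gamma> x0 w u) \<le> C * norm (\<gamma> t - x0) * norm w * norm u"
    and short: "2 * C * l \<le> k"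
  shows "norm (y 1) \<le> 2 * norm (y 0)"
    and "norm (y 1 - y 0) \<le> (2 * C * (1 + C) / k\<^sup>2) * l\<^sup>2 * norm (y 0)"
proof -
  have "l \<ge> 0" using has_integral_nonneg[OF \<sigma>(1)] \<sigma>(2) by blast
  have \<sigma>int: "\<sigma> integrable_on {0..t}" "integral {0..t} \<sigma> \<le> l" if "t \<in> {0..1}" for t
  proof -
    show i: "\<sigma> integrable_on {0..t}"
      using integrable_subinterval_real[of \<sigma> 0 1 0 t] \<sigma>(1) that by auto
    have "integral {0..t} \<sigma> \<le> integral {0..1} \<sigma>"
      using \<sigma> i that by (intro integral_subset_le) auto
    then show "integral {0..t} \<sigma> \<le> l" using integral_unique[OF \<sigma>(1)] by simp
  qed
  have "continuous_on {0..1} (\<lambda>t. norm (y t))" using assms(3) by (intro continuous_intros)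
  then obtain m where m: "m \<in> {0..1}" and max: "\<And>t. t \<in> {0..1} \<Longrightarrow> norm (y t) \<le> norm (y m)"
    using continuous_attains_sup[of "{0..1::real}" "\<lambda>t. norm (y t)"] by auto
  have speed': "norm (\<gamma>' t) \<le> \<sigma> t / k" if "t \<in> {0<..<1} - S" for t
    using speed[OF that] \<open>k > 0\<close> by (simp add: field_simps)
  have dist: "norm (y t - y 0) \<le> (C * norm (y m) / k) * l" if t: "t \<in> {0..1}" for t
  proof -
    have "norm (y t - y 0) \<le> integral {0..t} (\<lambda>s. (C * norm (y m) / k) * \<sigma> s)"
    proof (rule norm_diff_le_integral[where f' = "\<lambda>s. - \<Gamma> (\<gamma> s) (\<gamma>' s) (y s)"])
      fix s assume s: "s \<in> {0<..<t} - S"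
      then have s': "s \<in> {0<..<1} - S" using t by auto
      then have s01: "s \<in> {0..1}" by auto
      show "(y has_vector_derivative - \<Gamma> (\<gamma> s) (\<gamma>' s) (y s)) (at s)" by (rule y'[OF s'])
      have "norm (\<Gamma> (\<gamma> s) (\<gamma>' s) (y s)) \<le> C * norm (\<gamma>' s) * norm (y s)"
        by (rule \<Gamma>[OF s01])
      also have "\<dots> \<le> C * (\<sigma> s / k) * norm (y m)"
        using \<open>C \<ge> 0\<close> speed'[OF s'] max[OF s01] \<sigma>(2)[of s] \<open>k > 0\<close> by (intro mult_mono) auto
      finally show "norm (- \<Gamma> (\<gamma> s) (\<gamma>' s) (y s)) \<le> (C * norm (y m) / k) * \<sigma> s"
        by (simp add: mult_ac)
    qed (use assms(1,3) t \<open>C \<ge> 0\<close> \<open>k > 0\<close> \<sigma>(2) \<sigma>int[OF t] in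
        \<open>auto intro: continuous_on_subset intro!: integrable_on_mult_right mult_nonneg_nonneg\<close>)
    also have "\<dots> \<le> (C * norm (y m) / k) * l"
      using \<sigma>int(2)[OF t] \<open>C \<ge> 0\<close> \<open>k > 0\<close> by (simp add: mult_left_mono divide_right_mono)
    finally show ?thesis .
  qed
  \<comment> \<open>The assumption \<open>short\<close> serves this bound: it lets
    \<open>norm (y m)\<close> be absorbed into the left-hand side.\<close>
  have half: "C * l / k \<le> 1 / 2" using short \<open>k > 0\<close> by (simp add: field_simps)
  have "(C * norm (y m) / k) * l = (C * l / k) * norm (y m)" by simp
  also have "\<dots> \<le> 1 / 2 * norm (y m)" by (rule mult_right_mono[OF half]) simp
  finally have "norm (y m - y 0) \<le> 1 / 2 * norm (y m)" using dist[OF m] by linarith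
  moreover have "norm (y m) \<le> norm (y 0) + norm (y m - y 0)" by norm
  ultimately have ym: "norm (y m) \<le> 2 * norm (y 0)" by simp
  show "norm (y 1) \<le> 2 * norm (y 0)" using max[of 1] ym by simp
  have bil: "bounded_bilinear (\<Gamma> x0)" using assms(13) bilinear_conv_bounded_bilinear by blast
  \<comment> \<open>The coefficient of \<open>\<sigma> s\<close> in the sum of the two error terms:
    \<open>C\<close> comes from the variation of \<open>\<Gamma>\<close>, \<open>C\<^sup>2\<close>
    from the drift of \<open>y\<close>.\<close>
  define c where "c = (2 * C * (1 + C) / k\<^sup>2) * l * norm (y 0)"
  have "c \<ge> 0" unfolding c_def using \<open>C \<ge> 0\<close> \<open>l \<ge> 0\<close> by simp
  let ?f = "\<lambda>t. y t + \<Gamma> x0 (\<gamma> t) (y 0)"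
  have "norm (?f 1 - ?f 0) \<le> integral {0..1} (\<lambda>t. c * \<sigma> t)"
  proof (rule norm_diff_le_integral[where f' = "\<lambda>s. - \<Gamma> (\<gamma> s) (\<gamma>' s) (y s) + \<Gamma> x0 (\<gamma>' s) (y 0)"])
    show "continuous_on {0..1} ?f"
      using assms(2,3) by (intro continuous_intros bounded_bilinear.continuous_on[OF bil])
    fix s assume s: "s \<in> {0<..<1} - S"
    then have s01: "s \<in> {0..1}" by auto
    have "((\<lambda>t. \<Gamma> x0 (\<gamma> t) (y 0)) has_vector_derivative \<Gamma> x0 (\<gamma>' s) (y 0)) (at s)"
      by (rule bounded_linear.has_vector_derivative[OF bounded_bilinear.bounded_linear_left[OF bil] \<gamma>'[OF s]])
    then show "(?f has_vector_derivative - \<Gamma> (\<gamma> s) (\<gamma>' s) (y s) + \<Gamma> x0 (\<gamma>' s) (y 0)) (at s)"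
      using y'[OF s] by (rule has_vector_derivative_add[rotated])
    have dx: "norm (\<gamma> s - x0) \<le> l / k" using near[OF s01] \<open>k > 0\<close> by (simp add: field_simps)
    have "norm (\<Gamma> (\<gamma> s) (\<gamma>' s) (y s) - \<Gamma> x0 (\<gamma>' s) (y s)) \<le> C * norm (\<gamma> s - x0) * norm (\<gamma>' s) * norm (y s)"
      by (rule lip[OF s01])
    also have "\<dots> \<le> C * (l / k) * (\<sigma> s / k) * (2 * norm (y 0))"
      using \<open>C \<ge> 0\<close> dx speed'[OF s] order_trans[OF max[OF s01] ym] \<sigma>(2)[of s] \<open>k > 0\<close> \<open>l \<ge> 0\<close>
      by (intro mult_mono) auto
    finally have 1: "norm (\<Gamma> (\<gamma> s) (\<gamma>' s) (y s) - \<Gamma> x0 (\<gamma>' s) (y s)) \<le> C * (l / k) * (\<sigma> s / k) * (2 * norm (y 0))" .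
    \<comment> \<open>The bound along the curve at time 0 is the bound on
      \<open>\<Gamma> x0\<close>.\<close>
    have "norm (\<Gamma> x0 (\<gamma>' s) (y s - y 0)) \<le> C * norm (\<gamma>' s) * norm (y s - y 0)"
      using \<Gamma>[of 0] assms(4) by simp
    also have "\<dots> \<le> C * (\<sigma> s / k) * ((C * (2 * norm (y 0)) / k) * l)"
    proof (intro mult_mono)
      have "(C * norm (y m) / k) * l \<le> (C * (2 * norm (y 0)) / k) * l"
        using \<open>C \<ge> 0\<close> \<open>k > 0\<close> \<open>l \<ge> 0\<close> ym by (intro mult_right_mono divide_right_mono mult_left_mono) auto
      then show "norm (y s - y 0) \<le> (C * (2 * norm (y 0)) / k) * l" using dist[OF s01] by linarith
    qed (use \<open>C \<ge> 0\<close> \<open>k > 0\<close> \<sigma>(2) speed'[OF s] in auto)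
    finally have 2: "norm (\<Gamma> x0 (\<gamma>' s) (y s - y 0)) \<le> C * (\<sigma> s / k) * ((C * (2 * norm (y 0)) / k) * l)" .
    have "- \<Gamma> (\<gamma> s) (\<gamma>' s) (y s) + \<Gamma> x0 (\<gamma>' s) (y 0) =
        - ((\<Gamma> (\<gamma> s) (\<gamma>' s) (y s) - \<Gamma> x0 (\<gamma>' s) (y s)) + \<Gamma> x0 (\<gamma>' s) (y s - y 0))"
      by (simp add: bounded_bilinear.diff_right[OF bil])
    then have "norm (- \<Gamma> (\<gamma> s) (\<gamma>' s) (y s) + \<Gamma> x0 (\<gamma>' s) (y 0)) \<le>
        norm (\<Gamma> (\<gamma> s) (\<gamma>' s) (y s) - \<Gamma> x0 (\<gamma>' s) (y s)) + norm (\<Gamma> x0 (\<gamma>' s) (y s - y 0))"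
      by (simp only: norm_minus_cancel norm_triangle_ineq)
    also have "\<dots> \<le> C * (l / k) * (\<sigma> s / k) * (2 * norm (y 0)) + C * (\<sigma> s / k) * ((C * (2 * norm (y 0)) / k) * l)"
      by (rule add_mono[OF 1 2])
    also have "\<dots> = c * \<sigma> s"
      using \<open>k > 0\<close> by (simp add: c_def field_simps power2_eq_square)
    finally show "norm (- \<Gamma> (\<gamma> s) (\<gamma>' s) (y s) + \<Gamma> x0 (\<gamma>' s) (y 0)) \<le> c * \<sigma> s" .
  qed (use assms(1) \<sigma>(2) \<sigma>int[of 1] \<open>c \<ge> 0\<close> in \<open>auto intro!: integrable_on_mult_right\<close>)
  also have "\<dots> = c * l" using integral_unique[OF \<sigma>(1)] by simp
  finally show "norm (y 1 - y 0) \<le> (2 * C * (1 + C) / k\<^sup>2) * l\<^sup>2 * norm (y 0)"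
    using assms(4,5) by (simp add: c_def power2_eq_square mult_ac)
qed

text \<open>The speed bound is available only while the path is in the ball of radius
  \<open>\<rho>\<close>. Up to any such time the displacement is at most \<open>l / k\<close>,
  strictly less than \<open>\<rho>\<close>, so there is no first time of exit.\<close>

lemma short_path_in_chart:
  assumes riem: "riemannian_manifold X A g" and path: "piecewise_smooth_path X A \<alpha>"
    and c: "c \<in> charts_at A (\<alpha> 0)"
    and "finite S" and \<sigma>: "(\<sigma> has_integral l) {0..1}" "\<And>t. 0 \<le> \<sigma> t"
    and S: "\<And>t. t \<in> {0<..<1} - S \<Longrightarrow> c \<in> charts_at A (\<alpha> t) \<Longrightarrow>
      ((cmap c \<circ> \<alpha>) has_vector_derivative v t) (at t)"
    and speed: "\<And>t. t \<in> {0<..<1} - S \<Longrightarrow> c \<in> charts_at A (\<alpha> t) \<Longrightarrow>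
      cmap c (\<alpha> t) \<in> ball (cmap c (\<alpha> 0)) \<rho> \<Longrightarrow> k * norm (v t) \<le> \<sigma> t"
    and sub: "cball (cmap c (\<alpha> 0)) \<rho> \<subseteq> crange c" and "k > 0" "l < k * \<rho>"
    and t: "t \<in> {0..1}"
  shows "c \<in> charts_at A (\<alpha> t)" and "k * norm (cmap c (\<alpha> t) - cmap c (\<alpha> 0)) \<le> l"
proof -
  note M = riemannian_manifold_smooth_manifold[OF riem]
  have pathin: "pathin X \<alpha>" using path by (simp add: piecewise_smooth_path_def)
  define x0 where "x0 = cmap c (\<alpha> 0)"
  have cA: "c \<in> A" "\<alpha> 0 \<in> cdom c" using c by (auto simp: charts_at_def)
  have "l \<ge> 0" using has_integral_nonneg[OF \<sigma>(1)] \<sigma>(2) by blast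
  have "l / k < \<rho>" using \<open>k > 0\<close> \<open>l < k * \<rho>\<close> by (simp add: field_simps)
  then have "\<rho> > 0" using \<open>l \<ge> 0\<close> \<open>k > 0\<close> by (smt (verit) divide_nonneg_pos)
  \<comment> \<open>\<open>N\<close> is open and \<open>Q\<close> closed in \<open>X\<close>; the
    strict gap between \<open>l / k\<close> and \<open>\<rho>\<close> lies between them.\<close>
  define N where "N = {q \<in> cdom c. cmap c q \<in> ball x0 \<rho>}"
  define Q where "Q = {q \<in> cdom c. cmap c q \<in> cball x0 (l / k)}"
  have "Q \<subseteq> N" unfolding Q_def N_def using \<open>l / k < \<rho>\<close> by auto
  have displacement: "\<alpha> t \<in> Q" if t: "t \<in> {0..1}" and inN: "\<And>s. s \<in> {0..t} \<Longrightarrow> \<alpha> s \<in> N" for t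
  proof -
    have int: "\<sigma> integrable_on {0..t}"
      using integrable_subinterval_real[of \<sigma> 0 1 0 t] \<sigma>(1) t by auto
    have "continuous_on {0..t} (cmap c \<circ> \<alpha>)"
      by (rule chart_curve_continuous_on[OF M pathin cA(1)]) (use t inN in \<open>auto simp: N_def\<close>)
    then have "norm ((cmap c \<circ> \<alpha>) t - (cmap c \<circ> \<alpha>) 0) \<le> integral {0..t} (\<lambda>s. \<sigma> s / k)"
    proof (rule norm_diff_le_integral[where f' = v and S = S, rotated 2])
      fix s assume s: "s \<in> {0<..<t} - S"
      then have s': "s \<in> {0<..<1} - S" "c \<in> charts_at A (\<alpha> s)" "cmap c (\<alpha> s) \<in> ball x0 \<rho>"
        using t inN[of s] cA by (auto simp: N_def charts_at_def)
      show "((cmap c \<circ> \<alpha>) has_vector_derivative v s) (at s)" by (rule S[OF s'(1,2)])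
      show "norm (v s) \<le> \<sigma> s / k"
        using speed[OF s'(1,2) s'(3)[unfolded x0_def]] \<open>k > 0\<close> by (simp add: field_simps)
    qed (use t \<sigma>(2) int \<open>k > 0\<close> \<open>finite S\<close> in auto)
    also have "\<dots> = integral {0..t} \<sigma> / k" by simp
    also have "\<dots> \<le> integral {0..1} \<sigma> / k"
      using \<sigma> int t \<open>k > 0\<close> by (intro divide_right_mono integral_subset_le) auto
    also have "\<dots> = l / k" using integral_unique[OF \<sigma>(1)] by simp
    finally have "norm (cmap c (\<alpha> t) - x0) \<le> l / k" by (simp add: x0_def)
    then show ?thesis
      using inN[of t] t by (auto simp: Q_def N_def dist_norm norm_minus_commute)
  qed
  have "\<alpha> t \<in> N" if "t \<in> {0..1}" for t
  proof (rule ccontr)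
    assume "\<alpha> t \<notin> N"
    \<comment> \<open>The exit times form a compact set, whose least element \<open>\<tau>\<close>
      is the first exit time.\<close>
    define B where "B = {s \<in> {0..1}. \<alpha> s \<in> topspace X - N}"
    have top: "\<alpha> s \<in> topspace X" if "s \<in> {0..1}" for s
      using pathin that by (auto simp: pathin_def continuous_map_def)
    have "closedin X (topspace X - N)"
      unfolding N_def using chart_openin_vimage[OF M cA(1), of "ball x0 \<rho>"] by blast
    then have "closed B" unfolding B_def by (rule pathin_closed_vimage[OF pathin])
    moreover have "bounded B" unfolding B_def by (rule bounded_subset[of "{0..1}"]) auto
    moreover have "B \<noteq> {}" using \<open>\<alpha> t \<notin> N\<close> \<open>t \<in> {0..1}\<close> top unfolding B_def by blast
    ultimately obtain \<tau> where "\<tau> \<in> B" and min: "\<And>s. s \<in> B \<Longrightarrow> \<tau> \<le> s"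
      using compact_attains_inf[of B] compact_eq_bounded_closed by blast
    have \<tau>: "\<tau> \<in> {0..1}" "\<alpha> \<tau> \<notin> N" using \<open>\<tau> \<in> B\<close> by (auto simp: B_def)
    have before: "\<alpha> s \<in> N" if "s \<in> {0..<\<tau>}" for s
      using min[of s] that \<tau> top[of s] by (force simp: B_def)
    have "\<alpha> 0 \<in> N" unfolding N_def x0_def using cA \<open>\<rho> > 0\<close> by simp
    then have "\<tau> \<noteq> 0" using \<tau> by metis
    then have "\<tau> > 0" using \<tau> by simp
    \<comment> \<open>All earlier times land in \<open>Q\<close>. Its preimage is closed, so the
      limit time \<open>\<tau>\<close> lands in \<open>Q\<close> too, contradicting the exit from
      \<open>N\<close>.\<close>
    have "\<alpha> s \<in> Q" if "s \<in> {0..<\<tau>}" for s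
      by (rule displacement) (use that \<tau> before in auto)
    then have "{0..<\<tau>} \<subseteq> {s \<in> {0..1}. \<alpha> s \<in> Q}" using \<tau> by auto
    moreover have "closed {s \<in> {0..1}. \<alpha> s \<in> Q}"
      unfolding Q_def using sub \<open>l / k < \<rho>\<close>
      by (intro pathin_closed_vimage[OF pathin] chart_closedin_vimage[OF M cA(1)]) (auto simp: x0_def subset_iff)
    ultimately have "closure {0..<\<tau>} \<subseteq> {s \<in> {0..1}. \<alpha> s \<in> Q}" by (rule closure_minimal)
    moreover have "\<tau> \<in> closure {0..<\<tau>}" using \<open>\<tau> > 0\<close> by simp
    ultimately have "\<alpha> \<tau> \<in> Q" by blast
    then show False using \<tau>(2) \<open>Q \<subseteq> N\<close> by blast
  qed
  then have "\<alpha> t \<in> Q" using displacement[OF t] t by simp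
  then show "c \<in> charts_at A (\<alpha> t)" "k * norm (cmap c (\<alpha> t) - cmap c (\<alpha> 0)) \<le> l"
    using cA \<open>k > 0\<close> by (auto simp: Q_def charts_at_def x0_def dist_norm norm_minus_commute field_simps)
qed

text \<open>The constants are fixed before the loop and the field. Every parallel field is covered,
  because \<open>is_parallel_translation\<close> supplies for each vector merely some field ending
  at the translated vector.\<close>

lemma parallel_translation_short_loop:
  assumes riem: "riemannian_manifold X A g" and c: "c \<in> charts_at A p"
  shows "\<exists>\<delta>>0. \<exists>C\<ge>0. \<forall>\<alpha> Y. \<alpha> \<in> piecewise_smooth_loops X A p \<longrightarrow> curve_length A g \<alpha> < \<delta> \<longrightarrow>
    parallel_along A g \<alpha> Y \<longrightarrow> norm (Y 1 c) \<le> 2 * norm (Y 0 c) \<and>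
      norm (Y 1 c - Y 0 c) \<le> C * (curve_length A g \<alpha>)\<^sup>2 * norm (Y 0 c)"
proof -
  note M = riemannian_manifold_smooth_manifold[OF riem]
  define x0 where "x0 = cmap c p"
  have cA: "c \<in> A" "p \<in> cdom c" using c by (auto simp: charts_at_def)
  have "x0 \<in> crange c" using cA by (simp add: x0_def)
  let ?G = "metric_in_chart A g c" and ?\<Gamma> = "levi_civita A g c"
  have "\<exists>k>0. \<exists>\<rho>>0. \<exists>C\<ge>0. cball x0 \<rho> \<subseteq> crange c \<and> (\<forall>x\<in>cball x0 \<rho>.
    (\<forall>v. k\<^sup>2 * (norm v)\<^sup>2 \<le> ?G x v v) \<and>
    (\<forall>w u. norm (?\<Gamma> x w u) \<le> C * norm w * norm u) \<and>
    (\<forall>w u. norm (?\<Gamma> x w u - ?\<Gamma> x0 w u) \<le> C * norm (x - x0) * norm w * norm u))"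
    by (rule christoffel_local_bounds[OF riemannian_metric_on_chart[OF riem cA(1)]
          levi_civita_torsion_free_metric[OF riem cA(1)] \<open>x0 \<in> crange c\<close>])
  then obtain k \<rho> C where "k > 0" "\<rho> > 0" "C \<ge> 0" and sub: "cball x0 \<rho> \<subseteq> crange c" and
    *: "\<forall>x\<in>cball x0 \<rho>. (\<forall>v. k\<^sup>2 * (norm v)\<^sup>2 \<le> ?G x v v) \<and>
      (\<forall>w u. norm (?\<Gamma> x w u) \<le> C * norm w * norm u) \<and>
      (\<forall>w u. norm (?\<Gamma> x w u - ?\<Gamma> x0 w u) \<le> C * norm (x - x0) * norm w * norm u)"
    by (elim exE conjE)
  note bounds = bspec[OF *]
  \<comment> \<open>The first bound keeps the loop in the ball, the second gives
    \<open>2 * C * l \<le> k\<close>; \<open>C + 1\<close> covers the case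
    \<open>C = 0\<close>.\<close>
  define \<delta> where "\<delta> = min (k * \<rho>) (k / (2 * (C + 1)))"
  have "\<delta> > 0" using \<open>k > 0\<close> \<open>\<rho> > 0\<close> \<open>C \<ge> 0\<close> by (simp add: \<delta>_def)
  have "norm (Y 1 c) \<le> 2 * norm (Y 0 c) \<and>
      norm (Y 1 c - Y 0 c) \<le> (2 * C * (1 + C) / k\<^sup>2) * (curve_length A g \<alpha>)\<^sup>2 * norm (Y 0 c)"
    if \<alpha>: "\<alpha> \<in> piecewise_smooth_loops X A p" and "curve_length A g \<alpha> < \<delta>" and Y: "parallel_along A g \<alpha> Y" for \<alpha> Y
  proof -
    define l where "l = curve_length A g \<alpha>"
    have path: "piecewise_smooth_path X A \<alpha>" and ends: "\<alpha> 0 = p" "\<alpha> 1 = p"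
      using \<alpha> by (auto simp: piecewise_smooth_loops_def)
    have pathin: "pathin X \<alpha>" using path by (simp add: piecewise_smooth_path_def)
    let ?v = "\<lambda>t. velocity A \<alpha> t c"
    obtain S \<sigma> where "finite S" and \<sigma>: "(\<sigma> has_integral l) {0..1}" "\<forall>t. 0 \<le> \<sigma> t" and
      *: "\<forall>t\<in>{0<..<1} - S. \<forall>c\<in>charts_at A (\<alpha> t).
        ((cmap c \<circ> \<alpha>) has_vector_derivative velocity A \<alpha> t c) (at t) \<and>
        (\<sigma> t)\<^sup>2 = metric_in_chart A g c (cmap c (\<alpha> t)) (velocity A \<alpha> t c) (velocity A \<alpha> t c)"
      using path_speed[OF riem path] unfolding l_def by (elim exE conjE)
    note \<sigma> = \<sigma>(1) spec[OF \<sigma>(2)] and S = conjunct1[OF bspec[OF bspec[OF *]]]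
      and sq = conjunct2[OF bspec[OF bspec[OF *]]]
    obtain S' where "finite S'" and *: "\<forall>t\<in>{0<..<1} - S'. \<forall>c\<in>charts_at A (\<alpha> t).
        ((\<lambda>s. Y s c) has_vector_derivative
          - levi_civita A g c (cmap c (\<alpha> t)) (velocity A \<alpha> t c) (Y t c)) (at t)"
      using Y unfolding parallel_along_def by (elim exE conjE)
    note S' = bspec[OF bspec[OF *]]
    have speed: "k * norm (?v t) \<le> \<sigma> t"
      if "t \<in> {0<..<1} - S" "c \<in> charts_at A (\<alpha> t)" "cmap c (\<alpha> t) \<in> cball x0 \<rho>" for t
    proof (rule power2_le_imp_le)
      show "(k * norm (?v t))\<^sup>2 \<le> (\<sigma> t)\<^sup>2"
        using bounds[OF that(3)] sq[OF that(1,2)] by (simp add: power_mult_distrib)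
    qed (rule \<sigma>(2))
    have "l < k * \<rho>" using \<open>curve_length A g \<alpha> < \<delta>\<close> by (simp add: l_def \<delta>_def)
    have "l \<ge> 0" using has_integral_nonneg[OF \<sigma>(1)] \<sigma>(2) by blast
    note c0 = c[folded ends(1)]
    have slow: "k * norm (?v t) \<le> \<sigma> t" if "t \<in> {0<..<1} - S" "c \<in> charts_at A (\<alpha> t)"
      "cmap c (\<alpha> t) \<in> ball (cmap c (\<alpha> 0)) \<rho>" for t
      using speed[OF that(1,2)] that(3) by (simp add: ends(1) x0_def)
    note near = short_path_in_chart[where v = ?v and c = c, OF riem path c0 \<open>finite S\<close> \<sigma> S slow
        sub[unfolded x0_def, folded ends(1)] \<open>k > 0\<close> \<open>l < k * \<rho>\<close>]
    have stays: "c \<in> charts_at A (\<alpha> t)" if "t \<in> {0..1}" for t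
      by (rule near(1)[OF _ _ _ _ _ that])
    have close: "k * norm (cmap c (\<alpha> t) - x0) \<le> l" if "t \<in> {0..1}" for t
      unfolding x0_def ends(1)[symmetric] by (rule near(2)[OF _ _ _ _ _ that])
    have inball: "cmap c (\<alpha> t) \<in> cball x0 \<rho>" if "t \<in> {0..1}" for t
    proof -
      have "k * norm (cmap c (\<alpha> t) - x0) < k * \<rho>" using close[OF that] \<open>l < k * \<rho>\<close> by linarith
      then show ?thesis using \<open>k > 0\<close> by (simp add: dist_norm norm_minus_commute)
    qed
    have "l < k / (2 * (C + 1))" using \<open>curve_length A g \<alpha> < \<delta>\<close> by (simp add: l_def \<delta>_def)
    then have "2 * C * l + 2 * l < k" using \<open>C \<ge> 0\<close> by (simp add: field_simps)
    then have short: "2 * C * l \<le> k" using \<open>l \<ge> 0\<close> by linarith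
    have "finite (S \<union> S')" using \<open>finite S\<close> \<open>finite S'\<close> by simp
    have cont: "continuous_on {0..1} (cmap c \<circ> \<alpha>)"
      by (rule chart_curve_continuous_on[OF M pathin cA(1)]) (use stays in \<open>auto simp: charts_at_def\<close>)
    have contY: "continuous_on {0..1} (\<lambda>s. Y s c)"
      using Y stays unfolding parallel_along_def continuous_on_eq_continuous_within by blast
    have "bilinear (?\<Gamma> x0)"
      using levi_civita_torsion_free_metric[OF riem cA(1) \<open>x0 \<in> crange c\<close>]
      unfolding torsion_free_metric_def by blast
    have 1: "(cmap c \<circ> \<alpha>) 0 = x0" "(cmap c \<circ> \<alpha>) 1 = x0" by (simp_all add: ends x0_def)
    have 2: "((cmap c \<circ> \<alpha>) has_vector_derivative ?v t) (at t)"
      "((\<lambda>s. Y s c) has_vector_derivative - ?\<Gamma> ((cmap c \<circ> \<alpha>) t) (?v t) (Y t c)) (at t)"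
      "k * norm (?v t) \<le> \<sigma> t" if "t \<in> {0<..<1} - (S \<union> S')" for t
    proof -
      from that have t: "t \<in> {0<..<1} - S" "t \<in> {0<..<1} - S'" "t \<in> {0..1}" by auto
      show "((cmap c \<circ> \<alpha>) has_vector_derivative ?v t) (at t)"
        "((\<lambda>s. Y s c) has_vector_derivative - ?\<Gamma> ((cmap c \<circ> \<alpha>) t) (?v t) (Y t c)) (at t)"
        "k * norm (?v t) \<le> \<sigma> t"
        using S[OF t(1) stays[OF t(3)]] S'[OF t(2) stays[OF t(3)]]
          speed[OF t(1) stays[OF t(3)] inball[OF t(3)]] by (simp_all only: comp_apply)
    qed
    have 3: "k * norm ((cmap c \<circ> \<alpha>) t - x0) \<le> l"
      "norm (?\<Gamma> ((cmap c \<circ> \<alpha>) t) w u) \<le> C * norm w * norm u"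
      "norm (?\<Gamma> ((cmap c \<circ> \<alpha>) t) w u - ?\<Gamma> x0 w u) \<le> C * norm ((cmap c \<circ> \<alpha>) t - x0) * norm w * norm u"
      if "t \<in> {0..1}" for t w u
      using close[OF that] bounds[OF inball[OF that]] by (simp_all only: comp_apply)
    note est = parallel_loop_estimate[where \<gamma> = "cmap c \<circ> \<alpha>" and y = "\<lambda>s. Y s c" and \<gamma>' = ?v and \<Gamma> = ?\<Gamma>,
        OF \<open>finite (S \<union> S')\<close> cont contY 1 2(1,2) \<sigma> \<open>k > 0\<close> 2(3) 3(1) \<open>bilinear (?\<Gamma> x0)\<close> \<open>C \<ge> 0\<close> 3(2,3) short]
    have "norm (Y 1 c) \<le> 2 * norm (Y 0 c)" by (rule est(1))
    moreover have "norm (Y 1 c - Y 0 c) \<le> (2 * C * (1 + C) / k\<^sup>2) * l\<^sup>2 * norm (Y 0 c)" by (rule est(2))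
    ultimately show ?thesis by (simp only: l_def simp_thms)
  qed
  moreover have "2 * C * (1 + C) / k\<^sup>2 \<ge> 0" using \<open>C \<ge> 0\<close> by simp
  ultimately show ?thesis using \<open>\<delta> > 0\<close> by blast
qed

section \<open>From the holonomy estimate to a positive radius\<close>

text \<open>A difference of squares factors through \<open>u - Y 1\<close>, so for short loops the
  second-order estimate gives the square of the length times a constant multiple of the squared
  radius. The bound is stated loop by loop, before any infimum is taken.\<close>

lemma polarized_difference_bound:
  assumes riem: "riemannian_manifold X A g" and "p \<in> topspace X"
  shows "\<exists>r>0. \<forall>u\<in>tangent_space A p. \<forall>v\<in>tangent_space A p. \<forall>\<alpha> Y.
    tnorm g p u \<le> r \<longrightarrow> tnorm g p v \<le> r \<longrightarrow> \<alpha> \<in> piecewise_smooth_loops X A p \<longrightarrow>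
    parallel_along A g \<alpha> Y \<longrightarrow> Y 0 = u \<longrightarrow>
    (tnorm g p (u - v))\<^sup>2 - (tnorm g p (Y 1 - v))\<^sup>2 \<le> (curve_length A g \<alpha>)\<^sup>2"
proof -
  note M = riemannian_manifold_smooth_manifold[OF riem]
  obtain c where c: "c \<in> charts_at A p" using ex_chart_at[OF M assms(2)] by blast
  then have cA: "c \<in> A" "cmap c p \<in> crange c" by (auto simp: charts_at_def)
  define G where "G = metric_in_chart A g c (cmap c p)"
  have pd: "pos_def_form G"
    using riemannian_metric_on_chart[OF riem cA(1)] cA(2) unfolding riemannian_metric_on_def G_def by blast
  then have bil: "bilinear G" and sym: "\<And>u v. G u v = G v u" by (auto simp: pos_def_form_def)
  obtain k where "k > 0" and k: "\<And>v. k * (norm v)\<^sup>2 \<le> G v v" using pos_def_form_coercive[OF pd] by blast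
  obtain L where "L > 0" and L: "\<And>u v. norm (G u v) \<le> L * norm u * norm v"
    using bilinear_bounded_pos[OF bil] by blast
  obtain \<delta> C where "\<delta> > 0" "C \<ge> 0" and short: "\<And>\<alpha> Y. \<alpha> \<in> piecewise_smooth_loops X A p \<Longrightarrow>
      curve_length A g \<alpha> < \<delta> \<Longrightarrow> parallel_along A g \<alpha> Y \<Longrightarrow> norm (Y 1 c) \<le> 2 * norm (Y 0 c) \<and>
      norm (Y 1 c - Y 0 c) \<le> C * (curve_length A g \<alpha>)\<^sup>2 * norm (Y 0 c)"
    using parallel_translation_short_loop[OF riem c] by blast
  have tn: "(tnorm g p u)\<^sup>2 = G (u c) (u c)" if "u \<in> tangent_space A p" for u
  proof -
    have "G (u c) (u c) \<ge> 0" using k[of "u c"] \<open>k > 0\<close> by (smt (verit) mult_nonneg_nonneg zero_le_power2)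
    then show ?thesis using metric_in_chart_at[OF M c that that] by (simp add: tnorm_def G_def)
  qed
  \<comment> \<open>\<open>e\<close> bounds the squared chart norms of \<open>u\<close> and
    \<open>v\<close>. Its first bound settles long loops, where \<open>4 * L * e\<close> must not
    exceed \<open>\<delta>\<^sup>2\<close>; its second makes the factor \<open>5 * L * C * e\<close>
    for short loops at most 1, with 5 = 1 + 2 + 2 from \<open>a + w - 2 *\<^sub>R b\<close>.\<close>
  define e where "e = min (\<delta>\<^sup>2 / (4 * L)) (1 / (5 * L * C + 1))"
  have "e > 0" using \<open>\<delta> > 0\<close> \<open>L > 0\<close> \<open>C \<ge> 0\<close> by (simp add: e_def add_nonneg_pos)
  have e1: "4 * L * e \<le> \<delta>\<^sup>2"
  proof -
    have "4 * L * e \<le> 4 * L * (\<delta>\<^sup>2 / (4 * L))" using \<open>L > 0\<close> by (intro mult_left_mono) (auto simp: e_def)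
    then show ?thesis using \<open>L > 0\<close> by simp
  qed
  have e2: "5 * L * C * e \<le> 1"
  proof -
    have "5 * L * C * e \<le> (5 * L * C + 1) * (1 / (5 * L * C + 1))"
      using \<open>L > 0\<close> \<open>C \<ge> 0\<close> \<open>e > 0\<close> by (intro mult_mono) (auto simp: e_def)
    also have "\<dots> = 1" using \<open>L > 0\<close> \<open>C \<ge> 0\<close> by (smt (verit) divide_self_if mult_nonneg_nonneg nonzero_eq_divide_eq times_divide_eq_right)
    finally show ?thesis .
  qed
  \<comment> \<open>The radius is \<open>sqrt (k * e)\<close>: by coercivity it forces the chart
    norm below \<open>sqrt e\<close>.\<close>
  have small: "(norm (u c))\<^sup>2 \<le> e" if "u \<in> tangent_space A p" "tnorm g p u \<le> sqrt (k * e)" for u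
  proof -
    have "k * (norm (u c))\<^sup>2 \<le> (tnorm g p u)\<^sup>2" using k tn[OF that(1)] by simp
    moreover have "tnorm g p u \<ge> 0"
      using tn[OF that(1)] k[of "u c"] by (smt (verit) \<open>k > 0\<close> real_sqrt_ge_0_iff metric_in_chart_at[OF M c that(1) that(1)] G_def tnorm_def mult_nonneg_nonneg zero_le_power2)
    then have "(tnorm g p u)\<^sup>2 \<le> (sqrt (k * e))\<^sup>2" using that(2) by (intro power_mono)
    moreover have "(sqrt (k * e))\<^sup>2 = k * e" using \<open>k > 0\<close> \<open>e > 0\<close> by simp
    ultimately have "k * (norm (u c))\<^sup>2 \<le> k * e" by linarith
    then show ?thesis using \<open>k > 0\<close> by simp
  qed
  have "(tnorm g p (u - v))\<^sup>2 - (tnorm g p (Y 1 - v))\<^sup>2 \<le> (curve_length A g \<alpha>)\<^sup>2"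
    if u: "u \<in> tangent_space A p" "tnorm g p u \<le> sqrt (k * e)"
      and v: "v \<in> tangent_space A p" "tnorm g p v \<le> sqrt (k * e)"
      and \<alpha>: "\<alpha> \<in> piecewise_smooth_loops X A p" and Y: "parallel_along A g \<alpha> Y" "Y 0 = u" for u v \<alpha> Y
  proof -
    define l where "l = curve_length A g \<alpha>"
    define a b w where "a = u c" and "b = v c" and "w = Y 1 c"
    have ends: "\<alpha> 1 = p" using \<alpha> by (simp add: piecewise_smooth_loops_def)
    have "Y 1 \<in> tangent_space A p" using Y(1) ends unfolding parallel_along_def by force
    note diff = tangent_space_diff[OF M c u(1) v(1)] tangent_space_diff[OF M c this v(1)]
    have eq: "(tnorm g p (u - v))\<^sup>2 = G (a - b) (a - b)" "(tnorm g p (Y 1 - v))\<^sup>2 = G (w - b) (w - b)"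
      using tn[OF diff(1)] tn[OF diff(2)] by (simp_all add: a_def b_def w_def)
    have "norm a \<le> sqrt e" "norm b \<le> sqrt e"
      using small[OF u] small[OF v] by (simp_all add: a_def b_def real_le_rsqrt)
    show ?thesis
    proof (cases "l < \<delta>")
      case True
      have w: "norm w \<le> 2 * norm a" "norm (w - a) \<le> C * l\<^sup>2 * norm a"
        using short[OF \<alpha> True[unfolded l_def] Y(1)] Y(2) by (simp_all add: w_def a_def l_def)
      \<comment> \<open>The difference of two squares, with symmetry of \<open>G\<close>; the first
        factor is of second order in the length.\<close>
      have "G (a - b) (a - b) - G (w - b) (w - b) = G (a - w) (a + w - 2 *\<^sub>R b)"
        using sym[of w a] sym[of b a] sym[of b w]
        by (simp add: bilinear_lsub[OF bil] bilinear_rsub[OF bil] bilinear_radd[OF bil] bilinear_rmul[OF bil])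
      also have "\<dots> \<le> L * norm (a - w) * norm (a + w - 2 *\<^sub>R b)"
        using L[of "a - w" "a + w - 2 *\<^sub>R b"] by simp
      also have "\<dots> \<le> L * (C * l\<^sup>2 * sqrt e) * (5 * sqrt e)"
      proof (intro mult_mono)
        show "norm (a - w) \<le> C * l\<^sup>2 * sqrt e"
          using w(2) mult_left_mono[OF \<open>norm a \<le> sqrt e\<close>, of "C * l\<^sup>2"] \<open>C \<ge> 0\<close>
          by (simp add: norm_minus_commute)
        have "norm (a + w - 2 *\<^sub>R b) \<le> norm a + norm w + norm (2 *\<^sub>R b)"
          by norm
        then show "norm (a + w - 2 *\<^sub>R b) \<le> 5 * sqrt e"
          using w(1) \<open>norm a \<le> sqrt e\<close> \<open>norm b \<le> sqrt e\<close> by simp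
      qed (use \<open>L > 0\<close> \<open>C \<ge> 0\<close> \<open>e > 0\<close> in auto)
      also have "\<dots> = (5 * L * C * (sqrt e * sqrt e)) * l\<^sup>2" by simp
      also have "\<dots> = (5 * L * C * e) * l\<^sup>2" using \<open>e > 0\<close> by simp
      also have "\<dots> \<le> 1 * l\<^sup>2" by (rule mult_right_mono[OF e2]) simp
      finally show ?thesis using eq by (simp add: l_def)
    next
      case False
      have "norm (a - b) \<le> 2 * sqrt e"
        using norm_triangle_ineq4[of a b] \<open>norm a \<le> sqrt e\<close> \<open>norm b \<le> sqrt e\<close> by linarith
      have "G (a - b) (a - b) \<le> L * norm (a - b) * norm (a - b)" using L[of "a - b" "a - b"] by simp
      also have "\<dots> \<le> L * (2 * sqrt e) * (2 * sqrt e)"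
        using \<open>norm (a - b) \<le> 2 * sqrt e\<close> \<open>L > 0\<close> \<open>e > 0\<close> by (intro mult_mono) auto
      also have "\<dots> = 4 * L * (sqrt e * sqrt e)" by simp
      also have "\<dots> = 4 * L * e" using \<open>e > 0\<close> by simp
      also have "\<dots> \<le> \<delta>\<^sup>2" by (rule e1)
      also have "\<dots> \<le> l\<^sup>2" using False \<open>\<delta> > 0\<close> by (intro power_mono) auto
      finally show ?thesis
        using eq(1) zero_le_power2[of "tnorm g p (Y 1 - v)"] unfolding l_def by linarith
    qed
  qed
  moreover have "sqrt (k * e) > 0" using \<open>k > 0\<close> \<open>e > 0\<close> by simp
  ultimately show ?thesis by blast
qed

theorem theorem3p18:
  fixes X :: "'a topology"
    and A :: "('a, 'e::euclidean_space) chart set"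
    and g :: "('a, 'e) metric"
  assumes "riemannian_manifold X A g"
  shows "\<forall>p\<in>topspace X. holonomy_radius X A g p > 0"
proof
  fix p assume p: "p \<in> topspace X"
  obtain r where "r > 0" and r: "\<And>u v \<alpha> Y. u \<in> tangent_space A p \<Longrightarrow> v \<in> tangent_space A p \<Longrightarrow>
    tnorm g p u \<le> r \<Longrightarrow> tnorm g p v \<le> r \<Longrightarrow> \<alpha> \<in> piecewise_smooth_loops X A p \<Longrightarrow>
    parallel_along A g \<alpha> Y \<Longrightarrow> Y 0 = u \<Longrightarrow>
    (tnorm g p (u - v))\<^sup>2 - (tnorm g p (Y 1 - v))\<^sup>2 \<le> (curve_length A g \<alpha>)\<^sup>2"
    using polarized_difference_bound[OF assms p] by blast
  have "(tnorm g p (u - v))\<^sup>2 - (tnorm g p (a u - v))\<^sup>2 \<le> (length_norm X A g p a)\<^sup>2"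
    if u: "u \<in> tangent_space A p" "tnorm g p u \<le> r" and v: "v \<in> tangent_space A p" "tnorm g p v \<le> r"
      and a: "a \<in> holonomy X A g p" for u v a
  proof -
    let ?d = "(tnorm g p (u - v))\<^sup>2 - (tnorm g p (a u - v))\<^sup>2"
    let ?\<A> = "{curve_length A g \<alpha> | \<alpha>. \<alpha> \<in> piecewise_smooth_loops X A p \<and> is_parallel_translation A g p \<alpha> a}"
    \<comment> \<open>Membership in the holonomy group provides a loop; the infimum of a nonempty
      set dominates every lower bound.\<close>
    have "?\<A> \<noteq> {}" using a unfolding holonomy_def by blast
    \<comment> \<open>The infimum need not be attained, so all lengths are compared with one number.
      For negative \<open>?d\<close> the root is negative and the comparison still holds.\<close>
    moreover have "sqrt ?d \<le> l" if l: "l \<in> ?\<A>" for l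
    proof -
      obtain \<alpha> where \<alpha>: "l = curve_length A g \<alpha>" "\<alpha> \<in> piecewise_smooth_loops X A p"
        "is_parallel_translation A g p \<alpha> a" using l by blast
      then obtain Y where "parallel_along A g \<alpha> Y" "Y 0 = u" "Y 1 = a u"
        using u(1) unfolding is_parallel_translation_def by blast
      then have "?d \<le> l\<^sup>2" using r[OF u(1) v(1) u(2) v(2) \<alpha>(2)] \<alpha>(1) by metis
      moreover have "l \<ge> 0"
        using curve_length_nonneg[OF assms] \<alpha>(1,2) by (simp add: piecewise_smooth_loops_def)
      ultimately show ?thesis using real_le_lsqrt by blast
    qed
    ultimately have le: "sqrt ?d \<le> length_norm X A g p a"
      unfolding length_norm_def by (rule cInf_greatest)
    show ?thesis
    proof (cases "?d \<ge> 0")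
      case True
      then have "(sqrt ?d)\<^sup>2 \<le> (length_norm X A g p a)\<^sup>2" using le by (intro power_mono) simp_all
      then show ?thesis using True by simp
    next
      case False
      then show ?thesis using zero_le_power2[of "length_norm X A g p a"] by linarith
    qed
  qed
  then have "ennreal r \<le> holonomy_radius X A g p"
    unfolding holonomy_radius_def using \<open>r > 0\<close> by (intro Sup_upper imageI) blast
  then show "holonomy_radius X A g p > 0"
    using \<open>r > 0\<close> by (metis ennreal_less_zero_iff order_less_le_trans)
qed

end
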